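(* Let $\alpha\in(0,1/2)$ and let $(X_i)_{i=1}^\infty$, $(Y_i)_{i=1}^\infty$ be independent random variables, all uniformly distributed on $[0,1]$. Then the following two limits exist and coincide: $$\lim_{n\to\infty} n^{\alpha-1}\,\mathbb{E}\big[\mathsf{M}^D_\alpha((X_i)_{i=1}^n,(Y_i)_{i=1}^n)\big]=\lim_{n\to\infty} n^{\alpha-1}\,\mathbb{E}\big[\mathsf{M}_\alpha((X_i)_{i=1}^n,(Y_i)_{i=1}^n)\big].$$
   Context: For points $(x_i)_{i=1}^n,(y_i)_{i=1}^n\subseteq\mathbb{R}$, the assignment cost is $\mathsf{M}_\alpha((x_i)_{i=1}^n,(y_i)_{i=1}^n)=\min_{\sigma\in\mathcal{S}_n}\sum_{i=1}^n|x_i-y_{\sigma(i)}|^\alpha$, with $\mathcal{S}_n$ the set of permutations of $\{1,\dots,n\}$. For points $(x_i)_{i=1}^n,(y_i)_{i=1}^n\subseteq(0,1)$, the boundary functional is $$\mathsf{M}^D_\alpha((x_i)_{i=1}^n,(y_i)_{i=1}^n)=\inf\ \mathsf{M}_\alpha\big((x_i)_{i=1}^n\cup(\tilde x_j)_{j=1}^m,\ (y_i)_{i=1}^n\cup(\tilde y_j)_{j=1}^m\big),$$ where the infimum runs over all integers $m\ge0$ and all families (repetitions allowed) of boundary points $(\tilde x_j)_{j=1}^m,(\tilde y_j)_{j=1}^m\subseteq\{0,1\}$; the unions denote concatenated families of $n+m$ points. *)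

theory Defs
  imports "HOL-Probability.Probability"
begin

text \<open>Finite families of points are lists, so that the union of families (with repetitions) is
  \<open>@\<close>. Only lists of equal length are meant as arguments of the two functionals below.\<close>

definition assignment_cost :: "real \<Rightarrow> real list \<Rightarrow> real list \<Rightarrow> real" where
  "assignment_cost \<alpha> xs ys =
     Min ((\<lambda>\<sigma>. \<Sum>i<length xs. \<bar>xs ! i - ys ! \<sigma> i\<bar> powr \<alpha>) ` {\<sigma>. \<sigma> permutes {..<length xs}})"

definition boundary_assignment_cost :: "real \<Rightarrow> real list \<Rightarrow> real list \<Rightarrow> real" where
  "boundary_assignment_cost \<alpha> xs ys =
     Inf {assignment_cost \<alpha> (xs @ xs') (ys @ ys') | xs' ys'.
            length xs' = length ys' \<and> set xs' \<subseteq> {0, 1} \<and> set ys' \<subseteq> {0, 1}}"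

end

theory Submission
  imports Defs
begin

text \<open>Up to cancellation of common points, adding boundary points amounts to injecting a net charge
  \<open>a\<close> at \<open>0\<close> and extracting it at \<open>1\<close>. Let \<open>e(n, a)\<close> be the mean cost with a deterministic
  charge \<open>a\<close>. Cutting the interval in proportion \<open>m : n\<close> and injecting the same charge into both
  pieces, the charges at the cut cancel, while making the two samples have exactly \<open>m\<close> and \<open>n\<close>
  points costs \<open>O(\<surd>(m + n))\<close>. So \<open>n\<^sup>\<alpha> e(n, a)\<close> is subadditive up to
  \<open>O((m + n)\<^bsup>\<alpha> + 1/2\<^esup>)\<close>, uniformly in \<open>a\<close>; as \<open>\<alpha> + 1 / 2 < 1\<close>, the limit \<open>L\<close> exists for
  \<open>a = 0\<close>. Since \<open>e(N, a) \<ge> e(N, 0) - |a|\<close> and \<open>|a|\<close> becomes negligible along the multiples \<open>N\<close>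
  of \<open>n\<close>, also \<open>n\<^bsup>\<alpha> - 1\<^esup> e(n, a) \<ge> L - o(1)\<close> uniformly in \<open>a\<close>. Finally the optimal random charge may
  be taken from a grid of boundedly many values of spacing \<open>\<epsilon> n\<^bsup>1 - \<alpha>\<^esup>\<close>, and for each of them the
  cost deviates from its mean by \<open>O(\<surd>n) = o(n\<^bsup>1 - \<alpha>\<^esup>)\<close>.\<close>

section \<open>Transport plans\<close>

text \<open>The optimal charge depends on the sample, and two pieces of a cut sample would choose
  different charges, which do not cancel at the cut. Hence near-subadditivity is proved for each
  deterministic charge, and the randomness of the charge is dealt with only at the end. Two facts
  carry the proof. For \<open>\<alpha> \<le> 1\<close> the cost \<open>|x - y|^\<alpha>\<close> is a
  metric, so a point common to both sides may be cancelled; moving a point, undoing a charge and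
  reducing boundary points to a net charge all rest on this. And on the unit interval each of the 2
  n points influences the cost by at most 1, so the fluctuating number of points on one side of a
  cut, as well as the deviation of a cost from its mean, enters with an error of order sqrt n. This
  is of smaller order than n^(1 - \<alpha>) exactly when \<alpha> < 1/2. Functions that are Hoelder
  in each coordinate are continuous, so means can be iterated integrals over [0, 1]; measure theory
  serves only to identify expectations with them.\<close>

lemma powr_add_le_add_powr:
  fixes a b \<alpha> :: real
  assumes "0 \<le> a" "0 \<le> b" "0 < \<alpha>" "\<alpha> \<le> 1"
  shows "(a + b) powr \<alpha> \<le> a powr \<alpha> + b powr \<alpha>"
proof (cases "a + b = 0")
  case True then show ?thesis using assms by simp
next
  case False
  then have s: "a + b > 0" using assms by simp
  \<comment> \<open>After division by \<open>a + b\<close> both summands become ratios in [0, 1],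
    where raising to the power \<open>\<alpha> \<le> 1\<close> can only increase a number.\<close>
  have *: "c / (a + b) \<le> (c / (a + b)) powr \<alpha>" if "0 \<le> c" "c \<le> a + b" for c
  proof (cases "c = 0")
    case False
    have "(c / (a + b)) powr 1 \<le> (c / (a + b)) powr \<alpha>"
      using that s assms by (intro powr_mono') auto
    then show ?thesis using that s by simp
  qed simp
  have "1 = a / (a + b) + b / (a + b)" using s by (simp flip: add_divide_distrib)
  also have "\<dots> \<le> (a / (a + b)) powr \<alpha> + (b / (a + b)) powr \<alpha>"
    using assms by (intro add_mono *) auto
  also have "\<dots> = (a powr \<alpha> + b powr \<alpha>) / (a + b) powr \<alpha>"
    using assms by (simp add: powr_divide add_divide_distrib)
  finally show ?thesis using s by (simp add: field_simps)
qed

lemma abs_diff_powr_triangle: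
  fixes x y z \<alpha> :: real
  assumes "0 < \<alpha>" "\<alpha> \<le> 1"
  shows "\<bar>x - z\<bar> powr \<alpha> \<le> \<bar>x - y\<bar> powr \<alpha> + \<bar>y - z\<bar> powr \<alpha>"
proof -
  have "\<bar>x - z\<bar> powr \<alpha> \<le> (\<bar>x - y\<bar> + \<bar>y - z\<bar>) powr \<alpha>"
    using assms by (intro powr_mono2) auto
  also have "\<dots> \<le> \<bar>x - y\<bar> powr \<alpha> + \<bar>y - z\<bar> powr \<alpha>"
    using assms by (intro powr_add_le_add_powr) auto
  finally show ?thesis .
qed

text \<open>Plans are multisets of pairs rather than permutations, so that they can be added,
  shortened and rerouted without reindexing.\<close>

definition plan_cost :: "real \<Rightarrow> (real \<times> real) multiset \<Rightarrow> real" where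
  "plan_cost \<alpha> P = (\<Sum>(x, y)\<in>#P. \<bar>x - y\<bar> powr \<alpha>)"

lemma plan_cost_simps [simp]:
  "plan_cost \<alpha> {#} = 0"
  "plan_cost \<alpha> (add_mset (x, y) P) = \<bar>x - y\<bar> powr \<alpha> + plan_cost \<alpha> P"
  "plan_cost \<alpha> (P + Q) = plan_cost \<alpha> P + plan_cost \<alpha> Q"
  by (simp_all add: plan_cost_def)

lemma image_mset_fst_eq_mset:
  assumes "image_mset fst P = mset xs"
  shows "\<exists>ps. mset ps = P \<and> map fst ps = xs"
  using assms
proof (induction xs arbitrary: P)
  case Nil then show ?case by simp
next
  case (Cons x xs)
  then have "image_mset fst P = add_mset x (mset xs)" by simp
  from msed_map_invR[OF this]
  obtain p Q where "P = add_mset p Q" "fst p = x" "image_mset fst Q = mset xs" by auto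
  with Cons.IH[of Q] obtain ps where "mset ps = Q" "map fst ps = xs" by auto
  with \<open>P = _\<close> \<open>fst p = x\<close> show ?case by (intro exI[of _ "p # ps"]) auto
qed

text \<open>Sorting the pairs of \<open>P\<close> so that the first components spell
  \<open>xs\<close> leaves a rearrangement of \<open>ys\<close> in the second components, that is, a
  permutation. With \<open>assignment_cost_attained\<close> this describes the cost as a minimum
  over plans with given marginals.\<close>

lemma assignment_cost_le_plan_cost:
  assumes "image_mset fst P = mset xs" "image_mset snd P = mset ys"
  shows "assignment_cost \<alpha> xs ys \<le> plan_cost \<alpha> P"
proof -
  obtain ps where ps: "mset ps = P" "map fst ps = xs"
    using image_mset_fst_eq_mset[OF assms(1)] by blast
  have "mset (map snd ps) = mset ys" using ps assms by auto
  then obtain \<sigma> where \<sigma>: "\<sigma> permutes {..<length ys}" "permute_list \<sigma> ys = map snd ps"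
    using mset_eq_permutation by metis
  have len: "length ps = length xs" "length ys = length xs"
    using ps(2) \<sigma>(2) by (metis length_map, metis length_map length_permute_list)
  have "plan_cost \<alpha> P = (\<Sum>i<length xs. \<bar>xs ! i - ys ! \<sigma> i\<bar> powr \<alpha>)"
  proof -
    have "plan_cost \<alpha> P = (\<Sum>(x, y)\<leftarrow>ps. \<bar>x - y\<bar> powr \<alpha>)"
      by (simp add: plan_cost_def flip: ps(1) sum_mset_sum_list)
    also have "\<dots> = (\<Sum>i<length xs. \<bar>fst (ps ! i) - snd (ps ! i)\<bar> powr \<alpha>)"
      by (simp add: sum_list_sum_nth len case_prod_beta atLeast0LessThan)
    also have "\<dots> = (\<Sum>i<length xs. \<bar>xs ! i - ys ! \<sigma> i\<bar> powr \<alpha>)"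
    proof (intro sum.cong refl)
      fix i assume "i \<in> {..<length xs}"
      then have i: "i < length ps" "i < length ys" using len by auto
      have "fst (ps ! i) = xs ! i" using ps(2) i by auto
      moreover have "snd (ps ! i) = ys ! \<sigma> i"
        using \<sigma> i permute_list_nth[OF \<sigma>(1) i(2)] by (metis nth_map)
      ultimately show "\<bar>fst (ps ! i) - snd (ps ! i)\<bar> powr \<alpha> = \<bar>xs ! i - ys ! \<sigma> i\<bar> powr \<alpha>" by simp
    qed
    finally show ?thesis .
  qed
  then show ?thesis unfolding assignment_cost_def
    using \<sigma>(1) len by (intro Min_le) (auto simp: finite_permutations)
qed

lemma assignment_cost_attained:
  assumes "length xs = length ys"
  obtains P where "image_mset fst P = mset xs" "image_mset snd P = mset ys"
    "plan_cost \<alpha> P = assignment_cost \<alpha> xs ys"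
proof -
  let ?n = "length xs"
  have "assignment_cost \<alpha> xs ys \<in>
    (\<lambda>\<sigma>. \<Sum>i<?n. \<bar>xs ! i - ys ! \<sigma> i\<bar> powr \<alpha>) ` {\<sigma>. \<sigma> permutes {..<?n}}"
    unfolding assignment_cost_def
    by (intro Min_in) (auto simp: finite_permutations intro: permutes_id)
  then obtain \<sigma> where \<sigma>: "\<sigma> permutes {..<?n}"
    "assignment_cost \<alpha> xs ys = (\<Sum>i<?n. \<bar>xs ! i - ys ! \<sigma> i\<bar> powr \<alpha>)" by auto
  define P where "P = mset (zip xs (permute_list \<sigma> ys))"
  have "image_mset fst P = mset xs" "image_mset snd P = mset ys"
    using \<sigma> assms by (simp_all add: P_def flip: mset_map)
  moreover have "plan_cost \<alpha> P = assignment_cost \<alpha> xs ys"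
    unfolding P_def plan_cost_def \<sigma>(2)
    using \<sigma>(1) assms
    by (auto simp flip: mset_map simp: sum_mset_sum_list sum_list_sum_nth case_prod_beta
        atLeast0LessThan permute_list_nth intro!: sum.cong)
  ultimately show ?thesis using that by blast
qed

lemma assignment_cost_nonneg:
  assumes "length xs = length ys"
  shows "0 \<le> assignment_cost \<alpha> xs ys"
proof -
  obtain P where "plan_cost \<alpha> P = assignment_cost \<alpha> xs ys"
    using assignment_cost_attained[OF assms] by metis
  moreover have "0 \<le> plan_cost \<alpha> P" for P by (induction P) auto
  ultimately show ?thesis by metis
qed

lemma assignment_cost_mset_cong:
  assumes "mset xs = mset xs'" "mset ys = mset ys'" "length xs = length ys"
  shows "assignment_cost \<alpha> xs ys = assignment_cost \<alpha> xs' ys'"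
proof -
  have len: "length xs' = length ys'" using assms by (metis size_mset)
  obtain P where P: "image_mset fst P = mset xs" "image_mset snd P = mset ys"
    "plan_cost \<alpha> P = assignment_cost \<alpha> xs ys"
    using assignment_cost_attained[OF assms(3)] by metis
  obtain Q where Q: "image_mset fst Q = mset xs'" "image_mset snd Q = mset ys'"
    "plan_cost \<alpha> Q = assignment_cost \<alpha> xs' ys'"
    using assignment_cost_attained[OF len] by metis
  show ?thesis
    using assignment_cost_le_plan_cost[of P xs' ys' \<alpha>] assignment_cost_le_plan_cost[of Q xs ys \<alpha>]
      P Q assms by simp
qed

lemma assignment_cost_commute:
  assumes "length xs = length ys"
  shows "assignment_cost \<alpha> ys xs = assignment_cost \<alpha> xs ys"
proof -
  have *: "assignment_cost \<alpha> ys xs \<le> assignment_cost \<alpha> xs ys" if "length xs = length ys" for xs ys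
  proof -
    obtain P where P: "image_mset fst P = mset xs" "image_mset snd P = mset ys"
      "plan_cost \<alpha> P = assignment_cost \<alpha> xs ys"
      using assignment_cost_attained[OF \<open>length xs = length ys\<close>] by metis
    have "plan_cost \<alpha> (image_mset prod.swap P) = plan_cost \<alpha> P" for P
      by (induction P) (auto simp: abs_minus_commute)
    then show ?thesis using P
      assignment_cost_le_plan_cost[of "image_mset prod.swap P" ys xs \<alpha>]
      by (simp add: multiset.map_comp comp_def)
  qed
  show ?thesis using *[of xs ys] *[of ys xs] assms by simp
qed

lemma assignment_cost_append:
  assumes "length xs = length ys" "length us = length vs"
  shows "assignment_cost \<alpha> (xs @ us) (ys @ vs) \<le> assignment_cost \<alpha> xs ys + assignment_cost \<alpha> us vs"
proof -
  obtain P where P: "image_mset fst P = mset xs" "image_mset snd P = mset ys"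
    "plan_cost \<alpha> P = assignment_cost \<alpha> xs ys"
    using assignment_cost_attained[OF assms(1)] by metis
  obtain Q where Q: "image_mset fst Q = mset us" "image_mset snd Q = mset vs"
    "plan_cost \<alpha> Q = assignment_cost \<alpha> us vs"
    using assignment_cost_attained[OF assms(2)] by metis
  show ?thesis
    using assignment_cost_le_plan_cost[of "P + Q" "xs @ us" "ys @ vs" \<alpha>] P Q by simp
qed

text \<open>If an optimal plan sends \<open>z\<close> to \<open>y\<close> and \<open>x\<close> to
  \<open>z\<close>, then sending \<open>x\<close> straight to \<open>y\<close> removes the detour
  through \<open>z\<close> and is no dearer by the triangle inequality.\<close>

lemma assignment_cost_cancel1:
  assumes "length xs = length ys" "0 < \<alpha>" "\<alpha> \<le> 1"
  shows "assignment_cost \<alpha> xs ys \<le> assignment_cost \<alpha> (z # xs) (z # ys)"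
proof -
  have "length (z # xs) = length (z # ys)" using assms by simp
  then obtain P where P: "image_mset fst P = mset (z # xs)" "image_mset snd P = mset (z # ys)"
    "plan_cost \<alpha> P = assignment_cost \<alpha> (z # xs) (z # ys)"
    using assignment_cost_attained by metis
  have "image_mset fst P = add_mset z (mset xs)" using P(1) by simp
  from msed_map_invR[OF this] obtain y P' where
    P': "P = add_mset (z, y) P'" "image_mset fst P' = mset xs" by auto
  show ?thesis
  proof (cases "y = z")
    case True
    then have "image_mset snd P' = mset ys" using P(2) P' by simp
    from assignment_cost_le_plan_cost[OF P'(2) this, of \<alpha>] show ?thesis
      using P(3) P'(1) True by simp
  next
    case False
    then obtain K where "image_mset snd P' = add_mset z K" using P(2) P'(1)
      by (auto simp: add_eq_conv_ex)
    from msed_map_invR[OF this] obtain x P'' where P'': "P' = add_mset (x, z) P''" by auto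
    have "image_mset fst (add_mset (x, y) P'') = mset xs" using P'(2) P'' by simp
    moreover have "image_mset snd (add_mset (x, y) P'') = mset ys" using P(2) P'(1) P'' by simp
    ultimately have "assignment_cost \<alpha> xs ys \<le> plan_cost \<alpha> (add_mset (x, y) P'')"
      by (rule assignment_cost_le_plan_cost)
    also have "\<dots> \<le> plan_cost \<alpha> P" unfolding P'(1) P''
      using abs_diff_powr_triangle[OF assms(2,3), of x y z] by simp
    finally show ?thesis using P(3) by simp
  qed
qed

lemma assignment_cost_cancel:
  assumes "length xs = length ys" "0 < \<alpha>" "\<alpha> \<le> 1"
  shows "assignment_cost \<alpha> xs ys \<le> assignment_cost \<alpha> (zs @ xs) (zs @ ys)"
proof (induction zs)
  case (Cons z zs)
  show ?case using Cons.IH assignment_cost_cancel1[of "zs @ xs" "zs @ ys" \<alpha> z] assms by simp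
qed simp

lemma assignment_cost_singleton [simp]: "assignment_cost \<alpha> [x] [y] = \<bar>x - y\<bar> powr \<alpha>"
proof -
  have "{\<sigma>. \<sigma> permutes {..<Suc 0}} = {id}"
    using permutes_sing[of _ "0::nat"] by (auto simp: lessThan_Suc)
  then show ?thesis by (simp add: assignment_cost_def)
qed

text \<open>Insert \<open>x'\<close> on both sides by cancellation, let it take the place of
  \<open>x\<close> in the plan, and match the displaced \<open>x\<close> with the \<open>x'\<close>
  inserted on the other side.\<close>

lemma assignment_cost_move_le:
  assumes "length (xs @ x # ys) = length zs" "0 < \<alpha>" "\<alpha> \<le> 1"
  shows "assignment_cost \<alpha> (xs @ x # ys) zs \<le> assignment_cost \<alpha> (xs @ x' # ys) zs + \<bar>x - x'\<bar> powr \<alpha>"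
proof -
  have "assignment_cost \<alpha> (xs @ x # ys) zs \<le> assignment_cost \<alpha> (x' # xs @ x # ys) (x' # zs)"
    using assms by (intro assignment_cost_cancel1) auto
  also have "\<dots> = assignment_cost \<alpha> ((xs @ x' # ys) @ [x]) (zs @ [x'])"
    using assms by (intro assignment_cost_mset_cong) auto
  also have "\<dots> \<le> assignment_cost \<alpha> (xs @ x' # ys) zs + \<bar>x - x'\<bar> powr \<alpha>"
    using assms assignment_cost_append[of "xs @ x' # ys" zs "[x]" "[x']" \<alpha>] by simp
  finally show ?thesis .
qed

lemma assignment_cost_move:
  assumes "length (xs @ x # ys) = length zs" "0 < \<alpha>" "\<alpha> \<le> 1"
  shows "\<bar>assignment_cost \<alpha> (xs @ x # ys) zs - assignment_cost \<alpha> (xs @ x' # ys) zs\<bar> \<le> \<bar>x - x'\<bar> powr \<alpha>"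
  using assignment_cost_move_le[OF assms, of x'] assignment_cost_move_le[of xs x' ys zs \<alpha> x] assms
  by (simp add: abs_minus_commute abs_le_iff)

lemma assignment_cost_affine_le:
  assumes "length xs = length ys" "0 \<le> c"
  shows "assignment_cost \<alpha> (map (\<lambda>x. c * x + d) xs) (map (\<lambda>x. c * x + d) ys)
    \<le> c powr \<alpha> * assignment_cost \<alpha> xs ys"
proof -
  obtain P where P: "image_mset fst P = mset xs" "image_mset snd P = mset ys"
    "plan_cost \<alpha> P = assignment_cost \<alpha> xs ys"
    using assignment_cost_attained[OF assms(1)] by metis
  let ?g = "\<lambda>x. c * x + d"
  have "image_mset fst (image_mset (map_prod ?g ?g) P) = image_mset ?g (image_mset fst P)"
    "image_mset snd (image_mset (map_prod ?g ?g) P) = image_mset ?g (image_mset snd P)"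
    by (simp_all add: multiset.map_comp comp_def)
  moreover have "plan_cost \<alpha> (image_mset (map_prod ?g ?g) P) = c powr \<alpha> * plan_cost \<alpha> P" for P
  proof (induction P)
    case (add p P)
    have "\<bar>c * x + d - (c * y + d)\<bar> = c * \<bar>x - y\<bar>" for x y
      using assms(2) by (simp add: abs_mult flip: right_diff_distrib)
    then show ?case using add by (cases p) (simp add: powr_mult assms distrib_left)
  qed simp
  ultimately show ?thesis
    using assignment_cost_le_plan_cost[of "image_mset (map_prod ?g ?g) P" "map ?g xs" "map ?g ys" \<alpha>] P
    by simp
qed

lemma assignment_cost_replicate_le:
  assumes "\<bar>x - y\<bar> \<le> 1" "0 < \<alpha>"
  shows "assignment_cost \<alpha> (replicate k x) (replicate k y) \<le> k"
proof -
  have "\<bar>x - y\<bar> powr \<alpha> \<le> 1" using powr_mono2[of \<alpha> "\<bar>x - y\<bar>" 1] assms by simp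
  then have "plan_cost \<alpha> (replicate_mset k (x, y)) \<le> k" by (induction k) auto
  then show ?thesis
    using assignment_cost_le_plan_cost[of "replicate_mset k (x, y)" "replicate k x" "replicate k y" \<alpha>]
    by simp
qed

text \<open>All permutations give the same sum here. This is the source of the fact that a large
  charge is expensive.\<close>

lemma assignment_cost_replicate_ge:
  assumes "\<bar>x - y\<bar> = 1"
  shows "k \<le> assignment_cost \<alpha> (replicate k x) (replicate k y)"
proof -
  obtain \<sigma> where "\<sigma> permutes {..<k}"
    "assignment_cost \<alpha> (replicate k x) (replicate k y) =
       (\<Sum>i<k. \<bar>replicate k x ! i - replicate k y ! \<sigma> i\<bar> powr \<alpha>)"
  proof -
    have "assignment_cost \<alpha> (replicate k x) (replicate k y) \<in>
      (\<lambda>\<sigma>. \<Sum>i<k. \<bar>replicate k x ! i - replicate k y ! \<sigma> i\<bar> powr \<alpha>) ` {\<sigma>. \<sigma> permutes {..<k}}"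
      unfolding assignment_cost_def length_replicate
      by (intro Min_in) (auto simp: finite_permutations intro: permutes_id)
    then show ?thesis using that by auto
  qed
  then have "assignment_cost \<alpha> (replicate k x) (replicate k y) = (\<Sum>i<k. 1)"
    using assms permutes_in_image[of \<sigma> "{..<k}"] by (auto intro!: sum.cong)
  then show ?thesis by simp
qed

section \<open>Iterated means of coordinatewise Hoelder functions\<close>

lemma continuous_on_hoelder:
  fixes f :: "real \<Rightarrow> real"
  assumes "\<And>x y. x \<in> S \<Longrightarrow> y \<in> S \<Longrightarrow> \<bar>f x - f y\<bar> \<le> K * \<bar>x - y\<bar> powr \<alpha>" "0 < \<alpha>"
  shows "continuous_on S f"
  unfolding continuous_on_def
proof
  fix x assume x: "x \<in> S"
  have lim: "((\<lambda>y. K * \<bar>y - x\<bar> powr \<alpha>) \<longlongrightarrow> K * 0) (at x within S)"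
    using assms(2)
    by (intro tendsto_mult tendsto_const tendsto_zero_powrI[where b = \<alpha>] tendsto_rabs_zero)
      (auto intro!: tendsto_eq_intros)
  have "\<forall>\<^sub>F y in at x within S. norm (f y - f x) \<le> K * \<bar>y - x\<bar> powr \<alpha>"
    using assms(1) x by (auto simp: eventually_at_filter)
  from Lim_null_comparison[OF this] lim have "((\<lambda>y. f y - f x) \<longlongrightarrow> 0) (at x within S)"
    by simp
  then show "(f \<longlongrightarrow> f x) (at x within S)" by (rule LIM_zero_cancel)
qed

text \<open>With \<open>S = {0..1}\<close> and \<open>K = 1\<close> this contains the bounded
  difference condition behind the variance bound, and it supplies the continuity that makes iterated
  integrals exist. \<open>S = UNIV\<close> serves for measurability on the whole line.\<close>

definition coord_hoelder :: "real \<Rightarrow> real set \<Rightarrow> real \<Rightarrow> nat \<Rightarrow> (real list \<Rightarrow> real) \<Rightarrow> bool" where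
  "coord_hoelder \<alpha> S K N F \<longleftrightarrow>
     (\<forall>xs x x' ys. length (xs @ x # ys) = N \<longrightarrow> set (xs @ x # ys) \<subseteq> S \<longrightarrow> x' \<in> S \<longrightarrow>
        \<bar>F (xs @ x # ys) - F (xs @ x' # ys)\<bar> \<le> K * \<bar>x - x'\<bar> powr \<alpha>)"

lemma coord_hoelderI:
  assumes "\<And>xs x x' ys. length (xs @ x # ys) = N \<Longrightarrow> set (xs @ x # ys) \<subseteq> S \<Longrightarrow> x' \<in> S \<Longrightarrow>
        \<bar>F (xs @ x # ys) - F (xs @ x' # ys)\<bar> \<le> K * \<bar>x - x'\<bar> powr \<alpha>"
  shows "coord_hoelder \<alpha> S K N F"
  unfolding coord_hoelder_def using assms by blast

lemma coord_hoelderD: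
  assumes "coord_hoelder \<alpha> S K N F"
    and "length (xs @ x # ys) = N" "set (xs @ x # ys) \<subseteq> S" "x' \<in> S"
  shows "\<bar>F (xs @ x # ys) - F (xs @ x' # ys)\<bar> \<le> K * \<bar>x - x'\<bar> powr \<alpha>"
  using assms unfolding coord_hoelder_def by blast

lemma coord_hoelder_Cons:
  assumes "coord_hoelder \<alpha> S K (Suc N) F" "x \<in> S"
  shows "coord_hoelder \<alpha> S K N (\<lambda>xs. F (x # xs))"
proof (rule coord_hoelderI)
  fix xs y y' ys assume "length (xs @ y # ys) = N" "set (xs @ y # ys) \<subseteq> S" "y' \<in> S"
  then show "\<bar>F (x # xs @ y # ys) - F (x # xs @ y' # ys)\<bar> \<le> K * \<bar>y - y'\<bar> powr \<alpha>"
    using coord_hoelderD[OF assms(1), of "x # xs" y ys y'] assms(2) by simp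
qed

lemma coord_hoelder_head:
  assumes "coord_hoelder \<alpha> S K (Suc N) F" "x \<in> S" "x' \<in> S" "set xs \<subseteq> S" "length xs = N"
  shows "\<bar>F (x # xs) - F (x' # xs)\<bar> \<le> K * \<bar>x - x'\<bar> powr \<alpha>"
  using coord_hoelderD[OF assms(1), of "[]" x xs x'] assms by simp

lemma coord_hoelder_const: "coord_hoelder \<alpha> S 0 N (\<lambda>_. c)"
  by (rule coord_hoelderI) simp

lemma coord_hoelder_add:
  assumes "coord_hoelder \<alpha> S K N F" "coord_hoelder \<alpha> S L N G"
  shows "coord_hoelder \<alpha> S (K + L) N (\<lambda>xs. F xs + G xs)"
proof (rule coord_hoelderI)
  fix xs x x' ys assume *: "length (xs @ x # ys) = N" "set (xs @ x # ys) \<subseteq> S" "x' \<in> S"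
  show "\<bar>F (xs @ x # ys) + G (xs @ x # ys) - (F (xs @ x' # ys) + G (xs @ x' # ys))\<bar>
      \<le> (K + L) * \<bar>x - x'\<bar> powr \<alpha>"
    using coord_hoelderD[OF assms(1) *] coord_hoelderD[OF assms(2) *]
    unfolding distrib_right by linarith
qed

lemma coord_hoelder_cmult:
  assumes "coord_hoelder \<alpha> S K N F"
  shows "coord_hoelder \<alpha> S (\<bar>c\<bar> * K) N (\<lambda>xs. c * F xs)"
proof (rule coord_hoelderI)
  fix xs x x' ys assume *: "length (xs @ x # ys) = N" "set (xs @ x # ys) \<subseteq> S" "x' \<in> S"
  show "\<bar>c * F (xs @ x # ys) - c * F (xs @ x' # ys)\<bar> \<le> \<bar>c\<bar> * K * \<bar>x - x'\<bar> powr \<alpha>"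
    using mult_left_mono[OF coord_hoelderD[OF assms *] abs_ge_zero[of c]]
    by (simp add: abs_mult mult.assoc flip: right_diff_distrib)
qed

lemma coord_hoelder_abs:
  assumes "coord_hoelder \<alpha> S K N F"
  shows "coord_hoelder \<alpha> S K N (\<lambda>xs. \<bar>F xs\<bar>)"
proof (rule coord_hoelderI)
  fix xs x x' ys assume *: "length (xs @ x # ys) = N" "set (xs @ x # ys) \<subseteq> S" "x' \<in> S"
  show "\<bar>\<bar>F (xs @ x # ys)\<bar> - \<bar>F (xs @ x' # ys)\<bar>\<bar> \<le> K * \<bar>x - x'\<bar> powr \<alpha>"
    using coord_hoelderD[OF assms *] by linarith
qed

lemma coord_hoelder_diff_const:
  assumes "coord_hoelder \<alpha> S K N F"
  shows "coord_hoelder \<alpha> S K N (\<lambda>xs. F xs - c)"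
  using assms unfolding coord_hoelder_def by simp

lemma coord_hoelder_sum:
  assumes "\<And>i. i \<in> I \<Longrightarrow> coord_hoelder \<alpha> S (K i) N (F i)" "finite I"
  shows "coord_hoelder \<alpha> S (\<Sum>i\<in>I. K i) N (\<lambda>xs. \<Sum>i\<in>I. F i xs)"
  using assms(2,1)
proof (induction I)
  case empty
  then show ?case by (simp add: coord_hoelder_const)
next
  case (insert i I)
  have "coord_hoelder \<alpha> S (K i + (\<Sum>i\<in>I. K i)) N (\<lambda>xs. F i xs + (\<Sum>i\<in>I. F i xs))"
    by (intro coord_hoelder_add insert) auto
  then show ?case using insert by simp
qed

text \<open>The coordinates are exchanged one after another, each exchange costing at most
  \<open>K * d powr \<alpha>\<close>.\<close>

lemma coord_hoelder_diff_le:
  assumes "coord_hoelder \<alpha> S K N F" "0 < \<alpha>" "0 \<le> K"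
    and "length xs = N" "set xs \<subseteq> S" "set ys \<subseteq> S" "list_all2 (\<lambda>x y. \<bar>x - y\<bar> \<le> d) xs ys"
  shows "\<bar>F xs - F ys\<bar> \<le> K * N * d powr \<alpha>"
  using assms(1,4-)
proof (induction N arbitrary: F xs ys)
  case (Suc N)
  obtain x xs' where x: "xs = x # xs'" using Suc.prems by (metis length_Suc_conv)
  then obtain y ys' where y: "ys = y # ys'" using Suc.prems by (auto simp: list_all2_Cons1)
  have "\<bar>F (x # xs') - F (x # ys')\<bar> \<le> K * N * d powr \<alpha>"
    using Suc.prems x y Suc.IH[of "\<lambda>xs. F (x # xs)" xs' ys', OF coord_hoelder_Cons[OF Suc.prems(1)]]
    by auto
  moreover have "\<bar>F (x # ys') - F (y # ys')\<bar> \<le> K * \<bar>x - y\<bar> powr \<alpha>"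
    using Suc.prems x y list_all2_lengthD[of _ xs' ys']
    by (intro coord_hoelder_head[OF Suc.prems(1)]) auto
  moreover have "K * \<bar>x - y\<bar> powr \<alpha> \<le> K * d powr \<alpha>"
    using Suc.prems x y assms(2,3) by (intro mult_left_mono powr_mono2) auto
  moreover have "K * real (Suc N) * d powr \<alpha> = K * N * d powr \<alpha> + K * d powr \<alpha>"
    by (simp add: distrib_left distrib_right)
  ultimately show ?case unfolding x y by linarith
qed simp

text \<open>\<open>F\<close> is bounded on the cube, and a difference of squares is the sum times
  the difference. The value of \<open>L\<close> is immaterial: the lemma only licenses integrating
  squares.\<close>

lemma coord_hoelder_power2:
  assumes F: "coord_hoelder \<alpha> {0..1} K N F" and "0 < \<alpha>" "0 \<le> K"
  obtains L where "coord_hoelder \<alpha> {0..1} L N (\<lambda>xs. (F xs)\<^sup>2)"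
proof
  define B where "B = \<bar>F (replicate N 0)\<bar> + K * N"
  have B: "\<bar>F xs\<bar> \<le> B" if "length xs = N" "set xs \<subseteq> {0..1}" for xs
  proof -
    have "\<bar>F xs - F (replicate N 0)\<bar> \<le> K * N * 1 powr \<alpha>"
      using that by (intro coord_hoelder_diff_le[OF assms]) (auto simp: list_all2_conv_all_nth subset_iff in_set_conv_nth)
    then show ?thesis by (simp add: B_def)
  qed
  show "coord_hoelder \<alpha> {0..1} (2 * B * K) N (\<lambda>xs. (F xs)\<^sup>2)"
  proof (rule coord_hoelderI)
    fix xs ys :: "real list" and x x' :: real
    assume *: "length (xs @ x # ys) = N" "set (xs @ x # ys) \<subseteq> {0..1}" "x' \<in> {0..1}"
    have "\<bar>F (xs @ x # ys) + F (xs @ x' # ys)\<bar> \<le> 2 * B"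
      using B[of "xs @ x # ys"] B[of "xs @ x' # ys"] * by simp
    then have "\<bar>F (xs @ x # ys) + F (xs @ x' # ys)\<bar> * \<bar>F (xs @ x # ys) - F (xs @ x' # ys)\<bar>
       \<le> 2 * B * (K * \<bar>x - x'\<bar> powr \<alpha>)"
      using coord_hoelderD[OF F *] by (intro mult_mono) auto
    then show "\<bar>(F (xs @ x # ys))\<^sup>2 - (F (xs @ x' # ys))\<^sup>2\<bar> \<le> 2 * B * K * \<bar>x - x'\<bar> powr \<alpha>"
      by (simp add: power2_eq_square square_diff_square_factored abs_mult mult.assoc)
  qed
qed

text \<open>These maps turn a uniform variable into a point of the cube; below they are the identity
  and the two rescalings onto the pieces of a cut. Being 1-Lipschitz, they preserve Hoelder
  bounds.\<close>

definition unit_contraction :: "(real \<Rightarrow> real) \<Rightarrow> bool" where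
  "unit_contraction g \<longleftrightarrow> g ` {0..1} \<subseteq> {0..1} \<and>
     (\<forall>x\<in>{0..1}. \<forall>y\<in>{0..1}. \<bar>g x - g y\<bar> \<le> \<bar>x - y\<bar>)"

lemma unit_contraction_id [simp]: "unit_contraction (\<lambda>x. x)"
  by (auto simp: unit_contraction_def)

lemma unit_contraction_mem: "unit_contraction g \<Longrightarrow> x \<in> {0..1} \<Longrightarrow> g x \<in> {0..1}"
  unfolding unit_contraction_def by blast

section \<open>Iterated means: coupling, monotonicity, linearity\<close>

text \<open>The expectation of \<open>F (g\<^sub>1 U\<^sub>1, \<dots>, g\<^sub>n U\<^sub>n)\<close> for independent uniform \<open>U\<^sub>i\<close>; all integrands
  that occur are continuous, so iterated gauge integrals suffice.\<close>

fun unif_mean :: "(real \<Rightarrow> real) list \<Rightarrow> (real list \<Rightarrow> real) \<Rightarrow> real" where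
  "unif_mean [] F = F []"
| "unif_mean (g # gs) F = integral {0..1} (\<lambda>x. unif_mean gs (\<lambda>xs. F (g x # xs)))"

abbreviation apply_list :: "(real \<Rightarrow> real) list \<Rightarrow> real list \<Rightarrow> real list" where
  "apply_list gs xs \<equiv> map2 (\<lambda>g x. g x) gs xs"

abbreviation iid_mean :: "nat \<Rightarrow> (real list \<Rightarrow> real) \<Rightarrow> real" where
  "iid_mean N \<equiv> unif_mean (replicate N (\<lambda>x. x))"

lemma apply_list_mem:
  "list_all unit_contraction gs \<Longrightarrow> set xs \<subseteq> {0..1} \<Longrightarrow> set (apply_list gs xs) \<subseteq> {0..1}"
proof (induction gs arbitrary: xs)
  case (Cons g gs)
  show ?case
  proof (cases xs)
    case (Cons y ys)
    then show ?thesis using Cons.prems Cons.IH[of ys] unit_contraction_mem[of g y] by simp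
  qed simp
qed simp

lemma apply_list_id [simp]: "length xs = N \<Longrightarrow> apply_list (replicate N (\<lambda>x. x)) xs = xs"
  by (induction xs arbitrary: N) auto

lemma unif_mean_append:
  "unif_mean (gs @ hs) F = unif_mean gs (\<lambda>xs. unif_mean hs (\<lambda>ys. F (xs @ ys)))"
  by (induction gs arbitrary: F) auto

lemma unif_mean_const [simp]: "unif_mean gs (\<lambda>_. c) = c"
  by (induction gs) auto

text \<open>Continuity in the first coordinate follows from monotonicity of the mean over the
  others, while monotonicity is proved by comparing integrals and so needs continuity. To break the
  circle, monotonicity for \<open>gs\<close> is a premise here; the induction hypothesis of
  \<open>unif_mean_mono_maps\<close> provides it.\<close>

lemma unif_mean_continuous_aux:
  assumes mono: "\<And>F G K L d. coord_hoelder \<alpha> {0..1} K N F \<Longrightarrow> coord_hoelder \<alpha> {0..1} L N G \<Longrightarrow>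
      (\<And>xs. length xs = N \<Longrightarrow> set xs \<subseteq> {0..1} \<Longrightarrow>
        F (apply_list gs xs) \<le> G (apply_list gs xs) + d) \<Longrightarrow> unif_mean gs F \<le> unif_mean gs G + d"
    and F: "coord_hoelder \<alpha> {0..1} K (Suc N) F" and g: "unit_contraction g"
    and gs: "list_all unit_contraction gs" "length gs = N" and "0 < \<alpha>"
  shows "continuous_on {0..1} (\<lambda>x. unif_mean gs (\<lambda>xs. F (g x # xs)))"
proof (rule continuous_on_hoelder[OF _ \<open>0 < \<alpha>\<close>])
  have *: "unif_mean gs (\<lambda>xs. F (g x # xs)) \<le> unif_mean gs (\<lambda>xs. F (g y # xs)) + \<bar>K\<bar> * \<bar>x - y\<bar> powr \<alpha>"
    if xy: "x \<in> {0..1}" "y \<in> {0..1}" for x y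
  proof (rule mono)
    show "coord_hoelder \<alpha> {0..1} K N (\<lambda>xs. F (g x # xs))" "coord_hoelder \<alpha> {0..1} K N (\<lambda>xs. F (g y # xs))"
      using xy unit_contraction_mem[OF g] by (blast intro: coord_hoelder_Cons[OF F])+
    fix xs :: "real list" assume "length xs = N" "set xs \<subseteq> {0..1}"
    then have "\<bar>F (g x # apply_list gs xs) - F (g y # apply_list gs xs)\<bar> \<le> K * \<bar>g x - g y\<bar> powr \<alpha>"
      using unit_contraction_mem[OF g xy(1)] unit_contraction_mem[OF g xy(2)] gs
        apply_list_mem[OF gs(1), of xs]
      by (intro coord_hoelder_head[OF F]) auto
    also have "\<dots> \<le> \<bar>K\<bar> * \<bar>x - y\<bar> powr \<alpha>"
      using g xy \<open>0 < \<alpha>\<close> unfolding unit_contraction_def by (intro mult_mono powr_mono2) auto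
    finally show "F (g x # apply_list gs xs) \<le> F (g y # apply_list gs xs) + \<bar>K\<bar> * \<bar>x - y\<bar> powr \<alpha>" by simp
  qed
  show "\<bar>unif_mean gs (\<lambda>xs. F (g x # xs)) - unif_mean gs (\<lambda>xs. F (g y # xs))\<bar> \<le> \<bar>K\<bar> * \<bar>x - y\<bar> powr \<alpha>"
    if "x \<in> {0..1}" "y \<in> {0..1}" for x y
    using *[OF that] *[OF that(2,1)] by (simp add: abs_le_iff abs_minus_commute)
qed

text \<open>A coupling: both means are driven by the same uniform variables, so a pointwise
  comparison suffices even when \<open>gs\<close> and \<open>hs\<close> produce different
  laws.\<close>

lemma unif_mean_mono_maps:
  assumes "coord_hoelder \<alpha> {0..1} K N F" "coord_hoelder \<alpha> {0..1} L N G"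
    and "list_all unit_contraction gs" "length gs = N"
    and "list_all unit_contraction hs" "length hs = N" and "0 < \<alpha>"
    and "\<And>xs. length xs = N \<Longrightarrow> set xs \<subseteq> {0..1} \<Longrightarrow>
      F (apply_list gs xs) \<le> G (apply_list hs xs) + d"
  shows "unif_mean gs F \<le> unif_mean hs G + d"
  using assms(1-6,8)
proof (induction N arbitrary: gs hs F G d K L)
  case 0
  then show ?case by simp
next
  case (Suc N)
  obtain g gs' h hs' where eq: "gs = g # gs'" "hs = h # hs'"
    using Suc.prems(4,6) by (metis length_Suc_conv)
  note ok = Suc.prems(3-6)[unfolded eq, simplified]
  have cont: "continuous_on {0..1} (\<lambda>x. unif_mean fs (\<lambda>xs. H (f x # xs)))"
    if "coord_hoelder \<alpha> {0..1} J (Suc N) H" "list_all unit_contraction (f # fs)" "length fs = N"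
    for J H f fs
    using that by (intro unif_mean_continuous_aux[where N = N, OF Suc.IH]) (auto simp: \<open>0 < \<alpha>\<close>)
  have cF: "continuous_on {0..1} (\<lambda>x. unif_mean gs' (\<lambda>xs. F (g x # xs)))"
    and cG: "continuous_on {0..1} (\<lambda>x. unif_mean hs' (\<lambda>xs. G (h x # xs)))"
    using Suc.prems(1,2) ok by (auto intro!: cont)
  have "integral {0..1} (\<lambda>x. unif_mean gs' (\<lambda>xs. F (g x # xs)))
    \<le> integral {0..1} (\<lambda>x. unif_mean hs' (\<lambda>xs. G (h x # xs)) + d)"
  proof (intro integral_le integrable_continuous_interval cF cG continuous_intros)
    fix x :: real assume x: "x \<in> {0..1}"
    show "unif_mean gs' (\<lambda>xs. F (g x # xs)) \<le> unif_mean hs' (\<lambda>xs. G (h x # xs)) + d"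
    proof (rule Suc.IH)
      show "coord_hoelder \<alpha> {0..1} K N (\<lambda>xs. F (g x # xs))"
        by (intro coord_hoelder_Cons[OF Suc.prems(1)] unit_contraction_mem[OF _ x]) (simp add: ok)
      show "coord_hoelder \<alpha> {0..1} L N (\<lambda>xs. G (h x # xs))"
        by (intro coord_hoelder_Cons[OF Suc.prems(2)] unit_contraction_mem[OF _ x]) (simp add: ok)
      show "F (g x # apply_list gs' xs) \<le> G (h x # apply_list hs' xs) + d"
        if "length xs = N" "set xs \<subseteq> {0..1}" for xs
        using Suc.prems(7)[of "x # xs"] that x by (simp add: eq)
    qed (use ok in auto)
  qed
  also have "\<dots> = unif_mean hs G + d"
    using cG by (simp add: eq integral_add integrable_continuous_interval)
  finally show ?case by (simp add: eq)
qed


lemma unif_mean_continuous: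
  assumes "coord_hoelder \<alpha> {0..1} K (Suc N) F" "list_all unit_contraction (g # gs)"
    "length gs = N" "0 < \<alpha>"
  shows "continuous_on {0..1} (\<lambda>x. unif_mean gs (\<lambda>xs. F (g x # xs)))"
  using assms by (intro unif_mean_continuous_aux[where N = N, OF unif_mean_mono_maps]) auto

lemma unif_mean_mono:
  assumes "coord_hoelder \<alpha> {0..1} K N F" "coord_hoelder \<alpha> {0..1} L N G"
    and "list_all unit_contraction gs" "length gs = N" "0 < \<alpha>"
    and "\<And>xs. length xs = N \<Longrightarrow> set xs \<subseteq> {0..1} \<Longrightarrow> F xs \<le> G xs"
  shows "unif_mean gs F \<le> unif_mean gs G"
  using unif_mean_mono_maps[OF assms(1,2,3,4,3,4,5), of 0] assms(6) apply_list_mem[OF assms(3)] assms(4)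
  by simp

lemma unif_mean_cong:
  assumes "list_all unit_contraction gs"
    and "\<And>xs. length xs = length gs \<Longrightarrow> set xs \<subseteq> {0..1} \<Longrightarrow> F xs = G xs"
  shows "unif_mean gs F = unif_mean gs G"
  using assms
proof (induction gs arbitrary: F G)
  case (Cons g gs)
  show ?case unfolding unif_mean.simps
  proof (rule integral_cong, rule Cons.IH)
    show "list_all unit_contraction gs" using Cons.prems(1) by simp
  next
    fix x :: real and xs :: "real list"
    assume x: "x \<in> {0..1}" and xs: "length xs = length gs" "set xs \<subseteq> {0..1}"
    have "unit_contraction g" using Cons.prems(1) by simp
    from unit_contraction_mem[OF this x] xs show "F (g x # xs) = G (g x # xs)"
      by (intro Cons.prems(2)) simp_all
  qed
qed simp

lemma unif_mean_add:
  assumes "coord_hoelder \<alpha> {0..1} K N F" "coord_hoelder \<alpha> {0..1} L N G"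
    and "list_all unit_contraction gs" "length gs = N" "0 < \<alpha>"
  shows "unif_mean gs (\<lambda>xs. F xs + G xs) = unif_mean gs F + unif_mean gs G"
  using assms
proof (induction gs arbitrary: N F G)
  case (Cons g gs)
  then obtain M where N: "N = Suc M" by auto
  have "unif_mean (g # gs) (\<lambda>xs. F xs + G xs) =
    integral {0..1} (\<lambda>x. unif_mean gs (\<lambda>xs. F (g x # xs)) + unif_mean gs (\<lambda>xs. G (g x # xs)))"
    unfolding unif_mean.simps
  proof (rule integral_cong)
    fix x :: real assume x: "x \<in> {0..1}"
    have ok: "unit_contraction g" "list_all unit_contraction gs" "length gs = M"
      using Cons.prems(3,4) N by simp_all
    have gx: "g x \<in> {0..1}" by (rule unit_contraction_mem[OF ok(1) x])
    show "unif_mean gs (\<lambda>xs. F (g x # xs) + G (g x # xs)) =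
      unif_mean gs (\<lambda>xs. F (g x # xs)) + unif_mean gs (\<lambda>xs. G (g x # xs))"
      by (rule Cons.IH[OF coord_hoelder_Cons[OF Cons.prems(1)[unfolded N] gx]
          coord_hoelder_Cons[OF Cons.prems(2)[unfolded N] gx] ok(2,3) Cons.prems(5)])
  qed
  also have "\<dots> = unif_mean (g # gs) F + unif_mean (g # gs) G"
    unfolding unif_mean.simps
    using unif_mean_continuous[OF Cons.prems(1)[unfolded N] Cons.prems(3)]
      unif_mean_continuous[OF Cons.prems(2)[unfolded N] Cons.prems(3)] Cons.prems(4,5) N
    by (intro integral_add integrable_continuous_interval) auto
  finally show ?case .
qed simp

lemma unif_mean_cmult: "unif_mean gs (\<lambda>xs. c * F xs) = c * unif_mean gs F"
  by (induction gs arbitrary: F) auto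

lemma unif_mean_add_const:
  assumes "coord_hoelder \<alpha> {0..1} K N F" "list_all unit_contraction gs" "length gs = N" "0 < \<alpha>"
  shows "unif_mean gs (\<lambda>xs. F xs + c) = unif_mean gs F + c"
  using unif_mean_add[OF assms(1) coord_hoelder_const assms(2-4), of c] by simp

lemma unif_mean_sum:
  assumes "finite I" "\<And>i. i \<in> I \<Longrightarrow> coord_hoelder \<alpha> {0..1} (K i) N (F i)"
    and "list_all unit_contraction gs" "length gs = N" "0 < \<alpha>"
  shows "unif_mean gs (\<lambda>xs. \<Sum>i\<in>I. F i xs) = (\<Sum>i\<in>I. unif_mean gs (F i))"
  using assms(1,2)
proof (induction I)
  case (insert i I)
  have "unif_mean gs (\<lambda>xs. F i xs + (\<Sum>i\<in>I. F i xs)) =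
    unif_mean gs (F i) + unif_mean gs (\<lambda>xs. \<Sum>i\<in>I. F i xs)"
    using insert.prems insert.hyps assms
    by (intro unif_mean_add[where K = "K i" and L = "sum K I"] coord_hoelder_sum) auto
  then show ?case using insert by simp
qed simp

section \<open>Conditioning on the side of a cut\<close>

lemma integral_unit_split:
  fixes f :: "real \<Rightarrow> real"
  assumes f: "continuous_on {0..1} f" and t: "0 < t" "t < 1"
  shows "integral {0..1} f = t * integral {0..1} (\<lambda>x. f (t * x))
    + (1 - t) * integral {0..1} (\<lambda>x. f ((1 - t) * x + t))"
proof -
  have int: "f integrable_on {a..b}" if "0 \<le> a" "b \<le> 1" for a b
    using f that by (intro integrable_continuous_interval) (auto intro: continuous_on_subset)
  have "(f has_integral integral {0..t} f) (cbox 0 t)"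
    using int[of 0 t] t by (simp add: integrable_integral)
  from has_integral_affinity'[OF this t(1), of 0]
  have "integral {0..1} (\<lambda>x. f (t * x)) = integral {0..t} f / t"
    using t by (simp add: integral_unique divide_inverse mult.commute)
  moreover have "(f has_integral integral {t..1} f) (cbox t 1)"
    using int[of t 1] t by (simp add: integrable_integral)
  from has_integral_affinity'[OF this, of "1 - t" t] t
  have "integral {0..1} (\<lambda>x. f ((1 - t) * x + t)) = integral {t..1} f / (1 - t)"
    by (simp add: integral_unique divide_inverse mult.commute)
  moreover have "integral {0..1} f = integral {0..t} f + integral {t..1} f"
    using int[of 0 1] t by (simp add: Henstock_Kurzweil_Integration.integral_combine)
  ultimately show ?thesis using t by simp
qed

definition half_map :: "real \<Rightarrow> bool \<Rightarrow> real \<Rightarrow> real" where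
  "half_map t b x = (if b then t * x else (1 - t) * x + t)"

lemma unit_contraction_half_map [simp]:
  assumes "0 < t" "t < 1"
  shows "unit_contraction (half_map t b)"
proof (cases b)
  case True
  then show ?thesis using assms
    by (auto simp: unit_contraction_def half_map_def mult_le_one abs_mult mult_left_le_one_le
        simp flip: right_diff_distrib)
next
  case False
  have "(1 - t) * x + t \<le> 1" if "x \<le> 1" for x
    using mult_left_mono[of x 1 "1 - t"] that assms by (simp add: algebra_simps)
  with False show ?thesis using assms
    by (auto simp: unit_contraction_def half_map_def abs_mult mult_left_le_one_le
        simp flip: right_diff_distrib)
qed

text \<open>A uniform point falls into [0, t] with probability \<open>t\<close> and is then uniform
  there, and likewise in [t, 1]. This conditions a single coordinate on its side; the induction only
  carries the formula past the preceding coordinates.\<close>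

lemma unif_mean_mixture:
  assumes "coord_hoelder \<alpha> {0..1} K N F" "list_all unit_contraction (as @ bs)"
    "length (as @ bs) = N - 1" "0 < N" "0 < \<alpha>" "0 < t" "t < 1"
  shows "unif_mean (as @ (\<lambda>x. x) # bs) F = t * unif_mean (as @ half_map t True # bs) F
    + (1 - t) * unif_mean (as @ half_map t False # bs) F"
  using assms(1-4)
proof (induction as arbitrary: N F)
  case Nil
  obtain M where N: "N = Suc M" using Nil by (cases N) auto
  have "continuous_on {0..1} (\<lambda>x. unif_mean bs (\<lambda>xs. F (x # xs)))"
    using Nil assms N unif_mean_continuous[of \<alpha> K M F "\<lambda>x. x" bs] by simp
  from integral_unit_split[OF this assms(6,7)] show ?case by (simp add: half_map_def)
next
  case (Cons g as)
  then obtain M where N: "N = Suc M" by (cases N) auto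
  have "unif_mean ((g # as) @ (\<lambda>x. x) # bs) F =
    integral {0..1} (\<lambda>x. t * unif_mean (as @ half_map t True # bs) (\<lambda>xs. F (g x # xs))
      + (1 - t) * unif_mean (as @ half_map t False # bs) (\<lambda>xs. F (g x # xs)))"
    unfolding append_Cons unif_mean.simps
  proof (rule integral_cong)
    fix x :: real assume x: "x \<in> {0..1}"
    have ok: "unit_contraction g" "list_all unit_contraction (as @ bs)" "length (as @ bs) = M - 1" "0 < M"
      using Cons.prems(2,3) N by auto
    have gx: "g x \<in> {0..1}" by (rule unit_contraction_mem[OF ok(1) x])
    show "unif_mean (as @ (\<lambda>x. x) # bs) (\<lambda>xs. F (g x # xs)) =
      t * unif_mean (as @ half_map t True # bs) (\<lambda>xs. F (g x # xs))
      + (1 - t) * unif_mean (as @ half_map t False # bs) (\<lambda>xs. F (g x # xs))"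
      by (rule Cons.IH[OF coord_hoelder_Cons[OF Cons.prems(1)[unfolded N] gx] ok(2-4)])
  qed
  also have "\<dots> = integral {0..1} (\<lambda>x. t * unif_mean (as @ half_map t True # bs) (\<lambda>xs. F (g x # xs)))
      + integral {0..1} (\<lambda>x. (1 - t) * unif_mean (as @ half_map t False # bs) (\<lambda>xs. F (g x # xs)))"
    using Cons.prems assms(5-7) N
    by (intro integral_add integrable_continuous_interval continuous_intros
        unif_mean_continuous[OF Cons.prems(1)[unfolded N]]) auto
  finally show ?case by simp
qed

text \<open>Both maps take values in [0, 1], so exchanging them displaces one coordinate by at most
  1, whatever the underlying uniform variable is.\<close>

lemma unif_mean_switch:
  assumes "coord_hoelder \<alpha> {0..1} 1 N F" "list_all unit_contraction (as @ g # bs)"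
    "unit_contraction h" "length (as @ g # bs) = N" "0 < \<alpha>"
  shows "unif_mean (as @ g # bs) F \<le> unif_mean (as @ h # bs) F + 1"
proof (rule unif_mean_mono_maps[OF assms(1,1,2,4)])
  fix xs :: "real list" assume xs: "length xs = N" "set xs \<subseteq> {0..1}"
  define us v vs where "us = take (length as) xs" and "v = xs ! length as"
    and "vs = drop (Suc (length as)) xs"
  have eq: "xs = us @ v # vs" "length us = length as" "length vs = length bs"
    using id_take_nth_drop[of "length as" xs] assms(4) xs(1) by (auto simp: us_def v_def vs_def)
  have "v \<in> {0..1}" using xs eq by auto
  then have hv: "h v \<in> {0..1}" "g v \<in> {0..1}" using assms(2,3) unit_contraction_mem by auto
  have "\<bar>F (apply_list as us @ g v # apply_list bs vs) - F (apply_list as us @ h v # apply_list bs vs)\<bar>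
      \<le> 1 * \<bar>g v - h v\<bar> powr \<alpha>"
    using assms xs eq hv apply_list_mem[of as us] apply_list_mem[of bs vs]
    by (intro coord_hoelderD[OF assms(1)]) auto
  also have "\<dots> \<le> 1" using hv assms(5) powr_mono2[of \<alpha> "\<bar>g v - h v\<bar>" 1] by auto
  finally show "F (apply_list (as @ g # bs) xs) \<le> F (apply_list (as @ h # bs) xs) + 1"
    unfolding eq(1) using eq(2,3) by simp
qed (use assms in auto)

section \<open>Subsamples picked out by a word\<close>

definition select :: "bool list \<Rightarrow> 'a list \<Rightarrow> 'a list" where
  "select bs xs = map snd (filter fst (zip bs xs))"

lemma select_simps [simp]:
  "select [] xs = []" "select bs [] = []"
  "select (b # bs) (x # xs) = (if b then x # select bs xs else select bs xs)"
  by (auto simp: select_def)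

lemma select_append [simp]:
  "length bs = length xs \<Longrightarrow> select (bs @ bs') (xs @ xs') = select bs xs @ select bs' xs'"
  by (simp add: select_def)

lemma length_select: "length bs = length xs \<Longrightarrow> length (select bs xs) = count_list bs True"
  by (induction bs xs rule: list_induct2) auto

lemma set_select_subset: "set (select bs xs) \<subseteq> set xs"
  by (auto simp: select_def dest: set_zip_rightD)

text \<open>Coordinates marked \<open>False\<close> do not occur in the integrand and integrate out,
  so a deterministic choice of coordinates of an independent sample is again such a sample.\<close>

lemma iid_mean_select:
  "iid_mean (length bs) (\<lambda>xs. F (select bs xs)) = iid_mean (count_list bs True) F"
proof (induction bs arbitrary: F)
  case (Cons b bs)
  show ?case using Cons.IH[of "\<lambda>xs. F (_ # xs)"] Cons.IH[of F] by (cases b) simp_all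
qed simp

lemma coord_hoelder_select:
  assumes "coord_hoelder \<alpha> S K (count_list bs True) F" "0 \<le> K"
  shows "coord_hoelder \<alpha> S K (length bs) (\<lambda>xs. F (select bs xs))"
proof (rule coord_hoelderI)
  fix xs x x' ys assume *: "length (xs @ x # ys) = length bs" "set (xs @ x # ys) \<subseteq> S" "x' \<in> S"
  define as b cs where "as = take (length xs) bs" and "b = bs ! length xs"
    and "cs = drop (Suc (length xs)) bs"
  have bs: "bs = as @ b # cs" "length as = length xs"
    using *(1) id_take_nth_drop[of "length xs" bs] by (auto simp: as_def b_def cs_def)
  then have len: "length cs = length ys" using * by simp
  show "\<bar>F (select bs (xs @ x # ys)) - F (select bs (xs @ x' # ys))\<bar> \<le> K * \<bar>x - x'\<bar> powr \<alpha>"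
  proof (cases b)
    case True
    have "\<bar>F (select as xs @ x # select cs ys) - F (select as xs @ x' # select cs ys)\<bar> \<le> K * \<bar>x - x'\<bar> powr \<alpha>"
      using * bs len True set_select_subset[of as xs] set_select_subset[of cs ys]
      by (intro coord_hoelderD[OF assms(1)]) (auto simp: length_select)
    then show ?thesis using bs True by simp
  next
    case False
    then show ?thesis using bs assms by simp
  qed
qed

section \<open>Variance and mean absolute deviation\<close>

text \<open>A martingale argument: revealing the coordinates one at a time, each adds at most \<open>1\<close> to the
  variance.\<close>

lemma iid_mean_variance_le:
  assumes "coord_hoelder \<alpha> {0..1} 1 N F" "0 < \<alpha>"
  shows "iid_mean N (\<lambda>xs. (F xs - iid_mean N F)\<^sup>2) \<le> N"
  using assms(1)
proof (induction N arbitrary: F)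
  case (Suc N)
  define c where "c = iid_mean (Suc N) F"
  define m where "m x = iid_mean N (\<lambda>xs. F (x # xs))" for x
  have ids: "list_all unit_contraction (replicate k (\<lambda>x. x))" for k by (simp add: list_all_length)
  have m: "continuous_on {0..1} m" unfolding m_def
    using unif_mean_continuous[OF Suc.prems, of "\<lambda>x. x" "replicate N (\<lambda>x. x)"] ids assms(2) by simp
  have Fx: "coord_hoelder \<alpha> {0..1} 1 N (\<lambda>xs. F (x # xs))" if "x \<in> {0..1}" for x
    using Suc.prems that by (rule coord_hoelder_Cons)
  \<comment> \<open>Averaging over the later coordinates keeps the oscillation in the first one at
    most 1, so the mean \<open>c\<close> of \<open>m\<close> is within 1 of every
    \<open>m x\<close>.\<close>
  have osc: "m x \<le> m y + 1" if "x \<in> {0..1}" "y \<in> {0..1}" for x y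
    unfolding m_def
  proof (rule unif_mean_mono_maps[OF Fx[OF that(1)] Fx[OF that(2)] ids _ ids _ assms(2)])
    fix xs :: "real list" assume xs: "length xs = N" "set xs \<subseteq> {0..1}"
    have "\<bar>F (x # xs) - F (y # xs)\<bar> \<le> 1 * \<bar>x - y\<bar> powr \<alpha>"
      using xs that by (intro coord_hoelder_head[OF Suc.prems]) auto
    also have "\<dots> \<le> 1" using that assms(2) powr_mono2[of \<alpha> "\<bar>x - y\<bar>" 1] by auto
    finally show "F (x # apply_list (replicate N (\<lambda>x. x)) xs) \<le>
      F (y # apply_list (replicate N (\<lambda>x. x)) xs) + 1" using xs by simp
  qed auto
  have c: "c = integral {0..1} m" by (simp add: c_def m_def[abs_def])
  have mc: "(m x - c)\<^sup>2 \<le> 1" if x: "x \<in> {0..1}" for x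
  proof -
    have "integral {0..1} m \<le> integral {0..1} (\<lambda>_::real. m x + 1)"
      by (intro integral_le integrable_continuous_interval m) (use osc x in auto)
    moreover have "integral {0..1} (\<lambda>_::real. m x - 1) \<le> integral {0..1} m"
      by (intro integral_le integrable_continuous_interval m) (use osc[OF x] in \<open>auto simp: algebra_simps\<close>)
    ultimately show ?thesis unfolding c by (simp add: abs_square_le_1 abs_le_iff)
  qed
  have inner: "iid_mean N (\<lambda>xs. (F (x # xs) - c)\<^sup>2) \<le> real N + 1" if x: "x \<in> {0..1}" for x
  proof -
    define G where "G xs = F (x # xs) - m x" for xs
    have G: "coord_hoelder \<alpha> {0..1} 1 N G" unfolding G_def
      using Fx[OF x] by (rule coord_hoelder_diff_const)
    obtain L where G2: "coord_hoelder \<alpha> {0..1} L N (\<lambda>xs. (G xs)\<^sup>2)"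
      using coord_hoelder_power2[OF G assms(2)] by auto
    \<comment> \<open>Write \<open>F - c = G + (m x - c)\<close>. Since \<open>G\<close> has mean
      zero, the cross term vanishes; what remains is the variance over the later coordinates plus a
      square that is at most 1.\<close>
    have "iid_mean N (\<lambda>xs. (F (x # xs) - c)\<^sup>2) =
      iid_mean N (\<lambda>xs. (G xs)\<^sup>2 + (2 * (m x - c) * G xs + (m x - c)\<^sup>2))"
      by (intro unif_mean_cong ids) (auto simp: G_def power2_eq_square algebra_simps)
    also have "\<dots> = iid_mean N (\<lambda>xs. (G xs)\<^sup>2) + iid_mean N (\<lambda>xs. 2 * (m x - c) * G xs + (m x - c)\<^sup>2)"
      by (rule unif_mean_add[OF G2 coord_hoelder_add[OF coord_hoelder_cmult[OF G] coord_hoelder_const] ids])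
        (auto simp: assms)
    also have "iid_mean N (\<lambda>xs. 2 * (m x - c) * G xs + (m x - c)\<^sup>2) = 2 * (m x - c) * iid_mean N G + (m x - c)\<^sup>2"
      using unif_mean_add_const[OF coord_hoelder_cmult[OF G] ids _ assms(2)] by (simp add: unif_mean_cmult)
    also have "iid_mean N G = 0"
      using unif_mean_add_const[OF Fx[OF x] ids _ assms(2), where c = "- m x"] by (simp add: G_def[abs_def] m_def)
    also have "iid_mean N (\<lambda>xs. (G xs)\<^sup>2) \<le> N"
      using Suc.IH[OF Fx[OF x]] by (simp add: G_def m_def)
    finally show ?thesis using mc[OF x] by simp
  qed
  obtain L where F2: "coord_hoelder \<alpha> {0..1} L (Suc N) (\<lambda>xs. (F xs - c)\<^sup>2)"
    using coord_hoelder_power2[OF coord_hoelder_diff_const[OF Suc.prems] assms(2)] by auto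
  have "iid_mean (Suc N) (\<lambda>xs. (F xs - c)\<^sup>2) \<le> integral {0..1} (\<lambda>x::real. real N + 1)"
    unfolding replicate_Suc unif_mean.simps
    using unif_mean_continuous[OF F2, of "\<lambda>x. x" "replicate N (\<lambda>x. x)"] ids assms(2) inner
    by (intro integral_le integrable_continuous_interval) auto
  then show ?case by (simp add: c_def)
qed simp

text \<open>In place of the Cauchy-Schwarz inequality,
  \<open>|u| \<le> u^2 / (2 sqrt N) + sqrt N / 2\<close> is integrated; with variance at most
  \<open>N\<close> both terms contribute at most half of \<open>sqrt N\<close>.\<close>

lemma iid_mean_abs_deviation_le:
  assumes "coord_hoelder \<alpha> {0..1} 1 N F" "0 < \<alpha>"
  shows "iid_mean N (\<lambda>xs. \<bar>F xs - iid_mean N F\<bar>) \<le> sqrt N"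
proof (cases "N = 0")
  case False
  let ?c = "iid_mean N F"
  note F = coord_hoelder_diff_const[OF assms(1), of ?c]
  have ids: "list_all unit_contraction (replicate N (\<lambda>x. x))" by (simp add: list_all_length)
  obtain L where F2: "coord_hoelder \<alpha> {0..1} L N (\<lambda>xs. (F xs - ?c)\<^sup>2)"
    using coord_hoelder_power2[OF F assms(2)] by auto
  note F2' = coord_hoelder_cmult[OF F2, of "1 / (2 * sqrt N)"]
  have "iid_mean N (\<lambda>xs. \<bar>F xs - ?c\<bar>) \<le>
    iid_mean N (\<lambda>xs. 1 / (2 * sqrt N) * (F xs - ?c)\<^sup>2 + sqrt N / 2)"
  proof (rule unif_mean_mono[OF coord_hoelder_abs[OF F] coord_hoelder_add[OF F2' coord_hoelder_const] ids])
    fix xs :: "real list"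
    have "0 \<le> (\<bar>F xs - ?c\<bar> - sqrt N)\<^sup>2" by simp
    then have "2 * sqrt N * \<bar>F xs - ?c\<bar> \<le> (F xs - ?c)\<^sup>2 + sqrt N * sqrt N"
      by (simp add: power2_diff algebra_simps power2_eq_square abs_mult_self)
    then show "\<bar>F xs - ?c\<bar> \<le> 1 / (2 * sqrt N) * (F xs - ?c)\<^sup>2 + sqrt N / 2"
      using False by (simp add: field_simps)
  qed (use assms in auto)
  also have "\<dots> = 1 / (2 * sqrt N) * iid_mean N (\<lambda>xs. (F xs - ?c)\<^sup>2) + sqrt N / 2"
    using unif_mean_add_const[OF F2' ids _ assms(2)] by (simp only: unif_mean_cmult length_replicate)
  also have "\<dots> \<le> 1 / (2 * sqrt N) * N + sqrt N / 2"
    using iid_mean_variance_le[OF assms] by (intro add_right_mono mult_left_mono) auto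
  also have "\<dots> = sqrt N" using False real_sqrt_mult_self[of N] by (simp add: field_simps)
  finally show ?thesis .
qed simp

section \<open>Charged costs and their subadditivity\<close>

text \<open>Both samples sit in one list, the first \<open>n\<close> entries being the sources. A
  coordinate in the first half is moved directly, one in the second half after exchanging the roles
  of the two sides.\<close>

lemma coord_hoelder_assignment_cost:
  assumes "length us = length vs" "0 < \<alpha>" "\<alpha> \<le> 1"
  shows "coord_hoelder \<alpha> S 1 (2 * n) (\<lambda>zs. assignment_cost \<alpha> (take n zs @ us) (drop n zs @ vs))"
proof (rule coord_hoelderI)
  fix xs ys :: "real list" and x x' :: real
  assume len: "length (xs @ x # ys) = 2 * n"
  let ?C = "\<lambda>zs. assignment_cost \<alpha> (take n zs @ us) (drop n zs @ vs)"
  have "\<bar>?C (xs @ x # ys) - ?C (xs @ x' # ys)\<bar> \<le> \<bar>x - x'\<bar> powr \<alpha>"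
  proof (cases "length xs < n")
    case True
    define k where "k = n - length xs - 1"
    have "take n (xs @ z # ys) = xs @ z # take k ys" "drop n (xs @ z # ys) = drop k ys" for z
      using True by (auto simp: k_def take_Cons' drop_Cons')
    moreover have "length (xs @ x # take k ys @ us) = length (drop k ys @ vs)"
      using True len assms by (simp add: k_def)
    ultimately show ?thesis using assignment_cost_move[of xs x "take k ys @ us" "drop k ys @ vs" \<alpha> x']
      assms by simp
  next
    case False
    then have "take n (xs @ z # ys) = take n xs" "drop n (xs @ z # ys) = drop n xs @ z # ys" for z
      by simp_all
    moreover have l: "length (drop n xs @ z # ys @ vs) = length (take n xs @ us)" for z
      using False len assms by simp
    ultimately show ?thesis
      using assignment_cost_move[OF l assms(2,3), of x x']
        assignment_cost_commute[OF l[of x], of \<alpha>] assignment_cost_commute[OF l[of x'], of \<alpha>] by simp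
  qed
  then show "\<bar>?C (xs @ x # ys) - ?C (xs @ x' # ys)\<bar> \<le> 1 * \<bar>x - x'\<bar> powr \<alpha>" by simp
qed

text \<open>A net charge \<open>p - q\<close> is injected at \<open>0\<close> and extracted at \<open>1\<close>, to which the boundary
  points added in \<^const>\<open>boundary_assignment_cost\<close> amount.\<close>

definition charged_cost :: "real \<Rightarrow> nat \<Rightarrow> nat \<Rightarrow> nat \<Rightarrow> real list \<Rightarrow> real" where
  "charged_cost \<alpha> p q n zs =
     assignment_cost \<alpha> (take n zs @ replicate p 0 @ replicate q 1) (drop n zs @ replicate p 1 @ replicate q 0)"

definition charged_mean :: "real \<Rightarrow> nat \<Rightarrow> nat \<Rightarrow> nat \<Rightarrow> real" where
  "charged_mean \<alpha> p q n = iid_mean (2 * n) (charged_cost \<alpha> p q n)"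

lemma coord_hoelder_charged_cost:
  assumes "0 < \<alpha>" "\<alpha> \<le> 1"
  shows "coord_hoelder \<alpha> S 1 (2 * n) (charged_cost \<alpha> p q n)"
  unfolding charged_cost_def[abs_def] using assms by (intro coord_hoelder_assignment_cost) auto

text \<open>The number of letters \<open>True\<close> in a random word is within \<open>\<surd>N\<close> of its mean \<open>m\<close>. Instead of
  computing with the binomial law, a quadratic potential is propagated while the letters are
  revealed one at a time.\<close>

lemma random_word_le_balanced_word:
  fixes \<Phi> :: "'l list \<Rightarrow> real" and lab :: "bool \<Rightarrow> 'l" and U :: 'l and B t :: real and m N :: nat
  assumes mix: "\<And>v k. length v + Suc k = N \<Longrightarrow>
      \<Phi> (map lab v @ U # replicate k U) = t * \<Phi> (map lab v @ lab True # replicate k U)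
        + (1 - t) * \<Phi> (map lab v @ lab False # replicate k U)"
    and switch: "\<And>v w c d. length (v @ c # w) = N \<Longrightarrow>
      \<Phi> (map lab (v @ c # w)) \<le> \<Phi> (map lab (v @ d # w)) + 1"
    and bound: "\<And>v. length v = N \<Longrightarrow> count_list v True = m \<Longrightarrow> \<Phi> (map lab v) \<le> B"
    and N: "0 < N" "m \<le> N" "t = m / N"
  shows "\<Phi> (replicate N U) \<le> B + sqrt N"
proof -
  have t: "0 \<le> t" "t \<le> 1" using N by auto
  define s where "s = sqrt N"
  have s: "s > 0" using N by (simp add: s_def)
  \<comment> \<open>As long as the count is off, some letter can be flipped towards the target
    \<open>m\<close>; each flip costs 1 and reduces the defect by 1.\<close>
  have word: "\<Phi> (map lab v) \<le> B + \<bar>real (count_list v True) - m\<bar>" if "length v = N" for v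
    using that
  proof (induction "nat \<bar>int (count_list v True) - m\<bar>" arbitrary: v)
    case 0
    then show ?case using bound[of v] by simp
  next
    case (Suc j)
    define c where "c = (count_list v True > m)"
    have "c \<in> set v"
    proof (cases c)
      case True
      then show ?thesis unfolding c_def by (metis count_notin not_less0)
    next
      case False
      then have less: "count_list v True < N" using Suc.hyps(2) N by (auto simp: c_def)
      have "count_list v True = length v" if "False \<notin> set v"
        using that by (induction v) auto
      then show ?thesis using False less Suc.prems by auto
    qed
    then obtain a b where v: "v = a @ c # b" by (auto dest: split_list)
    let ?w = "a @ (\<not> c) # b"
    define x y where "x = count_list v True" and "y = count_list ?w True"
    have c: "c \<longleftrightarrow> x > m" by (simp add: c_def x_def)
    have "if c then x = Suc y else Suc x = y" by (auto simp: x_def y_def v)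
    then have xy: "x > m \<and> x = Suc y \<or> \<not> x > m \<and> Suc x = y" unfolding c by meson
    have j: "Suc j = nat \<bar>int x - m\<bar>" using Suc.hyps(2) by (simp add: x_def)
    have "j = nat \<bar>int y - m\<bar>" using xy j by arith
    then have "\<Phi> (map lab ?w) \<le> B + \<bar>real (count_list ?w True) - m\<bar>"
      using Suc.prems v unfolding y_def by (intro Suc.hyps(1)) auto
    moreover have "\<bar>real x - m\<bar> = \<bar>real y - m\<bar> + 1"
      using xy j by auto
    ultimately show ?case using switch[of a c b "\<not> c"] Suc.prems v
      by (simp add: x_def y_def)
  qed
  \<comment> \<open>The numerator is the second moment of (final count - \<open>m\<close>) given the
    prefix \<open>v\<close>: squared bias plus variance of \<open>k\<close> letters that are
    \<open>True\<close> with probability \<open>t\<close>. The term \<open>s / 2\<close> comes from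
    \<open>x \<le> s / 2 + x^2 / (2 s)\<close>, which replaces the defect by its square.\<close>
  have prefix: "\<Phi> (map lab v @ replicate k U) \<le>
      B + (s / 2 + ((count_list v True + k * t - m)\<^sup>2 + k * (t * (1 - t))) / (2 * s))"
    if "length v + k = N" for v k
    using that
  proof (induction k arbitrary: v)
    case 0
    define x where "x = \<bar>real (count_list v True) - m\<bar>"
    have "0 \<le> (x - s)\<^sup>2" by simp
    then have "x * (2 * s) \<le> s * s + x\<^sup>2" by (simp add: power2_eq_square algebra_simps)
    then have "x \<le> (s * s + x\<^sup>2) / (2 * s)" using s by (simp add: pos_le_divide_eq)
    also have "\<dots> = s / 2 + x\<^sup>2 / (2 * s)" using s by (simp add: add_divide_distrib)
    finally show ?case using word[of v] 0 by (simp add: x_def)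
  next
    case (Suc k)
    let ?c = "real (count_list v True)"
    let ?p = "\<lambda>x. B + (s / 2 + ((x + k * t - m)\<^sup>2 + k * (t * (1 - t))) / (2 * s))"
    have T: "\<Phi> (map lab v @ lab True # replicate k U) \<le> ?p (1 + ?c)"
      using Suc.IH[of "v @ [True]"] Suc.prems by simp
    have F: "\<Phi> (map lab v @ lab False # replicate k U) \<le> ?p ?c"
      using Suc.IH[of "v @ [False]"] Suc.prems by simp
    have "\<Phi> (map lab v @ replicate (Suc k) U) = t * \<Phi> (map lab v @ lab True # replicate k U)
        + (1 - t) * \<Phi> (map lab v @ lab False # replicate k U)"
      using mix[of v k] Suc.prems by simp
    also have "\<dots> \<le> t * ?p (1 + ?c) + (1 - t) * ?p ?c"
      using T F t by (intro add_mono mult_left_mono) auto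
    also have "\<dots> = B + (s / 2 + (t * ((1 + ?c + k * t - m)\<^sup>2 + k * (t * (1 - t)))
        + (1 - t) * ((?c + k * t - m)\<^sup>2 + k * (t * (1 - t)))) / (2 * s))"
      by (simp only: add_divide_distrib distrib_left left_diff_distrib mult_1 times_divide_eq_right
          diff_divide_distrib)
    \<comment> \<open>Averaging over one more letter preserves the second moment: that letter turns
      its share of the variance, \<open>t * (1 - t)\<close>, into spread of the bias.\<close>
    also have "t * ((1 + ?c + k * t - m)\<^sup>2 + k * (t * (1 - t)))
        + (1 - t) * ((?c + k * t - m)\<^sup>2 + k * (t * (1 - t)))
      = (?c + real (Suc k) * t - m)\<^sup>2 + real (Suc k) * (t * (1 - t))"
      by (simp add: power2_eq_square algebra_simps)
    finally show ?case .
  qed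
  have "real N * t = m" using N by simp
  then have "\<Phi> (replicate N U) \<le> B + (s / 2 + (N * (t * (1 - t))) / (2 * s))"
    using prefix[of "[]" N] by simp
  also have "\<dots> \<le> B + (s / 2 + (N * 1) / (2 * s))"
    using t s mult_mono[of t 1 "1 - t" 1] mult_left_mono[of "t * (1 - t)" 1 "real N"]
    by (intro add_left_mono divide_right_mono) auto
  also have "(N * 1) / (2 * s) = s / 2"
    using s real_sqrt_mult_self[of N] by (simp add: s_def field_simps)
  finally show ?thesis by (simp add: s_def)
qed

section \<open>Bisecting the interval\<close>

lemma mset_apply_half_map:
  assumes "length v = length xs"
  shows "mset (apply_list (map (half_map t) v) xs) =
    mset (map (half_map t True) (select v xs)) + mset (map (half_map t False) (select (map Not v) xs))"
  using assms by (induction v xs rule: list_induct2) auto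

text \<open>The charges created at the cut point \<open>t\<close> by the two halves cancel.\<close>

lemma assignment_cost_split:
  assumes t: "0 < t" "t < 1" and \<alpha>: "0 < \<alpha>" "\<alpha> \<le> 1"
    and len: "length xl = length yl" "length xr = length yr"
  shows "assignment_cost \<alpha>
      (map (half_map t True) xl @ map (half_map t False) xr @ replicate p 0 @ replicate q 1)
      (map (half_map t True) yl @ map (half_map t False) yr @ replicate p 1 @ replicate q 0)
    \<le> t powr \<alpha> * assignment_cost \<alpha> (xl @ replicate p 0 @ replicate q 1) (yl @ replicate p 1 @ replicate q 0)
      + (1 - t) powr \<alpha> * assignment_cost \<alpha> (xr @ replicate p 0 @ replicate q 1) (yr @ replicate p 1 @ replicate q 0)"
proof -
  let ?L = "map (half_map t True)" and ?R = "map (half_map t False)"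
  let ?x = "\<lambda>us. us @ replicate p (0::real) @ replicate q 1"
    and ?y = "\<lambda>us. us @ replicate p (1::real) @ replicate q 0"
  have "assignment_cost \<alpha> (?x (?L xl @ ?R xr)) (?y (?L yl @ ?R yr)) \<le>
    assignment_cost \<alpha> (replicate (p + q) t @ ?x (?L xl @ ?R xr)) (replicate (p + q) t @ ?y (?L yl @ ?R yr))"
    using len \<alpha> by (intro assignment_cost_cancel) auto
  also have "\<dots> = assignment_cost \<alpha> (?L (?x xl) @ ?R (?x xr)) (?L (?y yl) @ ?R (?y yr))"
    using len by (intro assignment_cost_mset_cong) (auto simp: half_map_def replicate_add add_ac)
  also have "\<dots> \<le> assignment_cost \<alpha> (?L (?x xl)) (?L (?y yl)) + assignment_cost \<alpha> (?R (?x xr)) (?R (?y yr))"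
    using len by (intro assignment_cost_append) auto
  also have "assignment_cost \<alpha> (?L (?x xl)) (?L (?y yl)) \<le> t powr \<alpha> * assignment_cost \<alpha> (?x xl) (?y yl)"
    using assignment_cost_affine_le[of "?x xl" "?y yl" t \<alpha> 0] len t
    by (simp add: half_map_def[abs_def])
  also have "assignment_cost \<alpha> (?R (?x xr)) (?R (?y yr)) \<le> (1 - t) powr \<alpha> * assignment_cost \<alpha> (?x xr) (?y yr)"
    using assignment_cost_affine_le[of "?x xr" "?y yr" "1 - t" \<alpha> t] len t
    by (simp add: half_map_def[abs_def])
  finally show ?thesis by simp
qed

text \<open>When both samples have exactly \<open>m\<close> points left of the cut, each piece
  carries a balanced problem on independent rescaled uniforms. The letters of \<open>v @ w\<close>
  select first the \<open>m\<close> sources and then the \<open>m\<close> targets of the left piece,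
  which is the layout that \<open>charged_cost\<close> expects; the negated word does the same for
  the right piece.\<close>

lemma unif_mean_charged_cost_balanced_le:
  assumes t: "0 < t" "t < 1" and \<alpha>: "0 < \<alpha>" "\<alpha> \<le> 1"
    and v: "length v = m + n" "count_list v True = m"
    and w: "length w = m + n" "count_list w True = m"
  shows "unif_mean (map (half_map t) (v @ w)) (charged_cost \<alpha> p q (m + n))
    \<le> t powr \<alpha> * charged_mean \<alpha> p q m + (1 - t) powr \<alpha> * charged_mean \<alpha> p q n"
proof -
  let ?vw = "v @ w" and ?nvw = "map Not (v @ w)"
  have notc: "count_list (map Not v) True = length v - count_list v True" for v :: "bool list"
    using count_le_length[of v True] by (induction v) (auto simp: Suc_diff_le count_le_length)
  have cnt: "count_list ?vw True = 2 * m" "count_list ?nvw True = 2 * n"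
    using v w notc[of v] notc[of w] by auto
  have lenvw: "length ?vw = 2 * (m + n)" "length ?nvw = 2 * (m + n)" using v w by auto
  define GL where "GL zs = charged_cost \<alpha> p q m (select ?vw zs)" for zs
  define GR where "GR zs = charged_cost \<alpha> p q n (select ?nvw zs)" for zs
  have GL: "coord_hoelder \<alpha> {0..1} 1 (2 * (m + n)) GL"
    unfolding GL_def[abs_def] lenvw(1)[symmetric] using \<alpha>
    by (intro coord_hoelder_select) (auto simp only: cnt coord_hoelder_charged_cost)
  have GR: "coord_hoelder \<alpha> {0..1} 1 (2 * (m + n)) GR"
    unfolding GR_def[abs_def] lenvw(2)[symmetric] using \<alpha>
    by (intro coord_hoelder_select) (auto simp only: cnt coord_hoelder_charged_cost)
  note G = coord_hoelder_cmult[OF GL, of "t powr \<alpha>"] coord_hoelder_cmult[OF GR, of "(1 - t) powr \<alpha>"]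
  have ids: "list_all unit_contraction (replicate k (\<lambda>x. x))" for k by (simp add: list_all_length)
  have "unif_mean (map (half_map t) ?vw) (charged_cost \<alpha> p q (m + n)) \<le>
    iid_mean (2 * (m + n)) (\<lambda>zs. t powr \<alpha> * GL zs + (1 - t) powr \<alpha> * GR zs) + 0"
  proof (rule unif_mean_mono_maps[OF coord_hoelder_charged_cost[OF \<alpha>] coord_hoelder_add[OF G] _ _ ids])
    show "list_all unit_contraction (map (half_map t) ?vw)"
      using t by (auto simp: list_all_iff)
    fix zs :: "real list" assume zs: "length zs = 2 * (m + n)"
    define xs ys where "xs = take (m + n) zs" and "ys = drop (m + n) zs"
    have zs_eq: "zs = xs @ ys" "length xs = m + n" "length ys = m + n"
      using zs by (auto simp: xs_def ys_def)
    let ?e = "replicate p (0::real) @ replicate q 1" and ?e' = "replicate p (1::real) @ replicate q 0"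
    let ?xl = "select v xs" and ?xr = "select (map Not v) xs"
      and ?yl = "select w ys" and ?yr = "select (map Not w) ys"
    have lens: "length ?xl = m" "length ?yl = m" "length ?xr = n" "length ?yr = n"
      using v w zs_eq notc[of v] notc[of w] by (simp_all add: length_select)
    have "charged_cost \<alpha> p q (m + n) (apply_list (map (half_map t) ?vw) zs) =
      assignment_cost \<alpha> (apply_list (map (half_map t) v) xs @ ?e) (apply_list (map (half_map t) w) ys @ ?e')"
      using v w zs_eq by (simp add: charged_cost_def)
    also have "\<dots> = assignment_cost \<alpha>
      (map (half_map t True) ?xl @ map (half_map t False) ?xr @ ?e)
      (map (half_map t True) ?yl @ map (half_map t False) ?yr @ ?e')"
      using v w zs_eq mset_apply_half_map[of v xs t] mset_apply_half_map[of w ys t]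
      by (intro assignment_cost_mset_cong) (simp_all del: mset_map)
    also have "\<dots> \<le> t powr \<alpha> * assignment_cost \<alpha> (?xl @ ?e) (?yl @ ?e')
      + (1 - t) powr \<alpha> * assignment_cost \<alpha> (?xr @ ?e) (?yr @ ?e')"
      using lens by (intro assignment_cost_split t \<alpha>) auto
    also have "\<dots> = t powr \<alpha> * GL zs + (1 - t) powr \<alpha> * GR zs"
      using v w zs_eq lens by (simp add: GL_def GR_def charged_cost_def)
    finally show "charged_cost \<alpha> p q (m + n) (apply_list (map (half_map t) ?vw) zs) \<le>
      t powr \<alpha> * GL (apply_list (replicate (2 * (m + n)) (\<lambda>x. x)) zs)
      + (1 - t) powr \<alpha> * GR (apply_list (replicate (2 * (m + n)) (\<lambda>x. x)) zs) + 0"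
      using zs by simp
  qed (use v w \<alpha> in auto)
  also have "\<dots> = t powr \<alpha> * iid_mean (2 * (m + n)) GL + (1 - t) powr \<alpha> * iid_mean (2 * (m + n)) GR"
    using unif_mean_add[OF G ids _ \<alpha>(1)] by (simp add: unif_mean_cmult)
  also have "iid_mean (2 * (m + n)) GL = charged_mean \<alpha> p q m"
    using iid_mean_select[of ?vw "charged_cost \<alpha> p q m"] unfolding lenvw cnt
    by (simp add: GL_def[abs_def] charged_mean_def)
  also have "iid_mean (2 * (m + n)) GR = charged_mean \<alpha> p q n"
    using iid_mean_select[of ?nvw "charged_cost \<alpha> p q n"] unfolding lenvw cnt
    by (simp add: GR_def[abs_def] charged_mean_def)
  finally show ?thesis .
qed

text \<open>The random word bound is applied once per sample, each time costing
  \<open>sqrt (m + n)\<close>: \<open>inner\<close> balances the second sample while the first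
  carries a balanced word, and its result is the bound \<open>B\<close> when the first sample is
  balanced in turn.\<close>

lemma charged_mean_split:
  assumes "0 < m" "0 < n" and \<alpha>: "0 < \<alpha>" "\<alpha> \<le> 1"
  shows "charged_mean \<alpha> p q (m + n) \<le>
    (m / (m + n)) powr \<alpha> * charged_mean \<alpha> p q m + (n / (m + n)) powr \<alpha> * charged_mean \<alpha> p q n
    + 2 * sqrt (m + n)"
proof -
  define N where "N = m + n"
  define t where "t = m / real N"
  have t: "0 < t" "t < 1" "1 - t = n / N" using assms(1,2) by (auto simp: t_def N_def field_simps)
  let ?F = "charged_cost \<alpha> p q N" and ?B = "t powr \<alpha> * charged_mean \<alpha> p q m + (1 - t) powr \<alpha> * charged_mean \<alpha> p q n"
  have F: "coord_hoelder \<alpha> {0..1} 1 (2 * N) ?F" by (intro coord_hoelder_charged_cost \<alpha>)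
  have ok: "list_all unit_contraction (map (half_map t) v)" for v
    using t by (auto simp: list_all_iff)
  have ids: "list_all unit_contraction (replicate k (\<lambda>x. x))" for k by (simp add: list_all_length)
  have inner: "unif_mean (map (half_map t) v @ replicate N (\<lambda>x. x)) ?F \<le> ?B + sqrt N"
    if v: "length v = N" "count_list v True = m" for v
  proof (rule random_word_le_balanced_word[where lab = "half_map t" and m = m and t = t
        and \<Phi> = "\<lambda>gs. unif_mean (map (half_map t) v @ gs) ?F"])
    fix u :: "bool list" and k assume "length u + Suc k = N"
    then show "unif_mean (map (half_map t) v @ map (half_map t) u @ (\<lambda>x. x) # replicate k (\<lambda>x. x)) ?F =
      t * unif_mean (map (half_map t) v @ map (half_map t) u @ half_map t True # replicate k (\<lambda>x. x)) ?F +
      (1 - t) * unif_mean (map (half_map t) v @ map (half_map t) u @ half_map t False # replicate k (\<lambda>x. x)) ?F"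
      using unif_mean_mixture[OF F, of "map (half_map t) (v @ u)" "replicate k (\<lambda>x. x)" t]
        v ok[of v] ok[of u] ids[of k] t \<alpha> by simp
  next
    fix u w :: "bool list" and c d assume "length (u @ c # w) = N"
    then show "unif_mean (map (half_map t) v @ map (half_map t) (u @ c # w)) ?F \<le>
      unif_mean (map (half_map t) v @ map (half_map t) (u @ d # w)) ?F + 1"
      using unif_mean_switch[OF F, of "map (half_map t) (v @ u)" "half_map t c" "map (half_map t) w" "half_map t d"]
        v ok[of v] ok[of u] ok[of w] t \<alpha> by simp
  next
    fix w :: "bool list" assume "length w = N" "count_list w True = m"
    then show "unif_mean (map (half_map t) v @ map (half_map t) w) ?F \<le> ?B"
      using unif_mean_charged_cost_balanced_le[OF t(1,2) \<alpha>, of v m n w p q] v by (simp add: N_def)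
  qed (use assms in \<open>auto simp: N_def t_def\<close>)
  have "unif_mean (replicate N (\<lambda>x. x) @ replicate N (\<lambda>x. x)) ?F \<le> (?B + sqrt N) + sqrt N"
  proof (rule random_word_le_balanced_word[where lab = "half_map t" and m = m and t = t
        and \<Phi> = "\<lambda>gs. unif_mean (gs @ replicate N (\<lambda>x. x)) ?F"])
    fix u :: "bool list" and k assume "length u + Suc k = N"
    then show "unif_mean ((map (half_map t) u @ (\<lambda>x. x) # replicate k (\<lambda>x. x)) @ replicate N (\<lambda>x. x)) ?F =
      t * unif_mean ((map (half_map t) u @ half_map t True # replicate k (\<lambda>x. x)) @ replicate N (\<lambda>x. x)) ?F +
      (1 - t) * unif_mean ((map (half_map t) u @ half_map t False # replicate k (\<lambda>x. x)) @ replicate N (\<lambda>x. x)) ?F"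
      using unif_mean_mixture[OF F, of "map (half_map t) u" "replicate k (\<lambda>x. x) @ replicate N (\<lambda>x. x)" t]
        ok[of u] ids[of k] ids[of N] t \<alpha> by simp
  next
    fix u w :: "bool list" and c d assume "length (u @ c # w) = N"
    then show "unif_mean (map (half_map t) (u @ c # w) @ replicate N (\<lambda>x. x)) ?F \<le>
      unif_mean (map (half_map t) (u @ d # w) @ replicate N (\<lambda>x. x)) ?F + 1"
      using unif_mean_switch[OF F, of "map (half_map t) u" "half_map t c"
          "map (half_map t) w @ replicate N (\<lambda>x. x)" "half_map t d"]
        ok[of u] ok[of w] ids[of N] t \<alpha> by simp
  qed (use assms inner in \<open>auto simp: N_def t_def\<close>)
  moreover have "charged_mean \<alpha> p q (m + n) = unif_mean (replicate N (\<lambda>x. x) @ replicate N (\<lambda>x. x)) ?F"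
    by (simp only: charged_mean_def N_def mult_2 replicate_add)
  ultimately have "charged_mean \<alpha> p q (m + n) \<le> ?B + 2 * sqrt N" by simp
  then show ?thesis unfolding t(3) by (simp only: t_def N_def of_nat_add)
qed

section \<open>The limit\<close>

text \<open>Adding \<open>D n\<^sup>\<beta>\<close> absorbs the error term as long as the two summands are
  comparable; balanced bisection of \<open>q\<close> needs nothing more.\<close>

lemma near_subadditive_multiple:
  fixes h :: "nat \<Rightarrow> real" and C \<beta> :: real
  assumes sub: "\<And>m n. 0 < m \<Longrightarrow> 0 < n \<Longrightarrow> h (m + n) \<le> h m + h n + C * real (m + n) powr \<beta>"
    and "0 \<le> C" "\<beta> < 1" and D: "D = C / ((3 / 2) powr (1 - \<beta>) - 1)"
    and "0 < q" "0 < n"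
  shows "h (q * n) + D * real (q * n) powr \<beta> \<le> q * (h n + D * real n powr \<beta>)"
proof -
  \<comment> \<open>If neither part exceeds 2/3 of the sum, then
    \<open>a powr \<beta> + b powr \<beta>\<close> is at least \<open>1 + c\<close> times
    \<open>(a + b) powr \<beta>\<close>. Since \<open>D * c = C\<close>, the surplus in the
    correction term pays for the error of one addition.\<close>
  define c where "c = (3 / 2) powr (1 - \<beta>) - (1 :: real)"
  have "1 < (3 / 2 :: real) powr (1 - \<beta>)" using assms by simp
  then have c: "0 < c" by (simp add: c_def)
  have D0: "0 \<le> D" "D * c = C"
    using c assms(2) unfolding D c_def[symmetric] by simp_all
  have term_ge: "(1 + c) * (real a * s powr (\<beta> - 1)) \<le> real a powr \<beta>"
    if "0 < a" "3 * real a \<le> 2 * s" for a :: nat and s :: real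
  proof -
    have "(2 / 3 * s) powr (\<beta> - 1) \<le> real a powr (\<beta> - 1)"
      by (rule powr_mono2') (use that assms(3) in auto)
    moreover have "(2 / 3 * s) powr (\<beta> - 1) = (2 / 3) powr (\<beta> - 1) * s powr (\<beta> - 1)"
      by (rule powr_mult)
    moreover have "(2 / 3 :: real) powr (\<beta> - 1) = 1 + c"
      using powr_minus_divide[of "2 / 3 :: real" "1 - \<beta>"] by (simp add: c_def powr_divide)
    ultimately have "real a * ((1 + c) * s powr (\<beta> - 1)) \<le> real a * real a powr (\<beta> - 1)"
      by (intro mult_left_mono) auto
    also have "\<dots> = real a powr \<beta>" using that powr_mult_base[of "real a" "\<beta> - 1"] by simp
    finally show ?thesis by (simp add: mult_ac)
  qed
  have comparable: "h (a + b) + D * real (a + b) powr \<beta> \<le>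
      (h a + D * real a powr \<beta>) + (h b + D * real b powr \<beta>)"
    if "0 < a" "0 < b" "a \<le> 2 * b" "b \<le> 2 * a" for a b
  proof -
    let ?s = "real (a + b)"
    have "?s powr \<beta> = real a * ?s powr (\<beta> - 1) + real b * ?s powr (\<beta> - 1)"
      using that powr_mult_base[of ?s "\<beta> - 1"] by (simp add: distrib_right)
    then have "(1 + c) * ?s powr \<beta> = (1 + c) * (real a * ?s powr (\<beta> - 1)) + (1 + c) * (real b * ?s powr (\<beta> - 1))"
      by (simp only: distrib_left)
    also have "\<dots> \<le> real a powr \<beta> + real b powr \<beta>"
      using that by (intro add_mono term_ge) auto
    finally have "D * ((1 + c) * ?s powr \<beta>) \<le> D * (real a powr \<beta> + real b powr \<beta>)"
      using D0 by (intro mult_left_mono)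
    moreover have "D * ((1 + c) * ?s powr \<beta>) = D * ?s powr \<beta> + C * ?s powr \<beta>"
      using D0(2) by (simp add: distrib_right flip: D0(2)) (simp add: algebra_simps)
    ultimately show ?thesis using sub[OF that(1,2)] by (simp add: distrib_left)
  qed
  show ?thesis using \<open>0 < q\<close>
  proof (induction q rule: less_induct)
    case (less q)
    show ?case
    proof (cases "q = 1")
      case False
      \<comment> \<open>For \<open>q \<ge> 2\<close> the two halves differ by a factor of at most 2,
        the extreme case being \<open>q = 3\<close>.\<close>
      define a b where "a = q div 2" and "b = q - q div 2"
      have ab: "q = a + b" "0 < a" "0 < b" "a < q" "b < q" "a \<le> 2 * b" "b \<le> 2 * a"
        using less.prems False by (auto simp: a_def b_def)
      have "h (a * n + b * n) + D * real (a * n + b * n) powr \<beta> \<le>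
        (h (a * n) + D * real (a * n) powr \<beta>) + (h (b * n) + D * real (b * n) powr \<beta>)"
        using ab \<open>0 < n\<close> mult_le_mono1[of a "2 * b" n] mult_le_mono1[of b "2 * a" n]
        by (intro comparable) (auto simp: mult.assoc)
      also have "\<dots> \<le> a * (h n + D * real n powr \<beta>) + b * (h n + D * real n powr \<beta>)"
        using ab by (intro add_mono less.IH) auto
      finally show ?thesis by (simp add: ab(1) add_mult_distrib distrib_right)
    qed simp
  qed
qed

text \<open>Fekete's argument for the corrected quotient \<open>u\<close>, which does not increase
  on passing from an index to a multiple. The limit is the infimum of \<open>u\<close>, since the
  correction vanishes relative to \<open>n\<close>.\<close>

lemma near_subadditive_convergent:
  fixes h :: "nat \<Rightarrow> real" and C \<beta> :: real
  assumes sub: "\<And>m n. 0 < m \<Longrightarrow> 0 < n \<Longrightarrow> h (m + n) \<le> h m + h n + C * real (m + n) powr \<beta>"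
    and C: "0 \<le> C" and \<beta>: "\<beta> < 1" and nonneg: "\<And>n. 0 \<le> h n"
  obtains L where "(\<lambda>n. h n / n) \<longlonglongrightarrow> L"
proof
  define D where "D = C / ((3 / 2) powr (1 - \<beta>) - 1)"
  have "1 < (3 / 2 :: real) powr (1 - \<beta>)" using \<beta> by simp
  then have D: "0 \<le> D" using C by (simp add: D_def)
  define u where "u n = (h n + D * real n powr \<beta>) / n" for n
  have u: "0 \<le> u n" for n using nonneg D by (simp add: u_def)
  define L where "L = (INF n\<in>{0<..}. u n)"
  have Lu: "L \<le> u n" if "0 < n" for n
    unfolding L_def using u that by (intro cINF_lower bdd_belowI[of _ 0]) auto
  have pow: "real n powr \<beta> / n = real n powr (\<beta> - 1)" for n
    by (cases "n = 0") (simp_all add: powr_diff)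
  have null: "(\<lambda>n. real n powr (\<beta> - 1)) \<longlonglongrightarrow> 0"
    using \<beta> by (intro tendsto_neg_powr filterlim_real_sequentially) auto
  show "(\<lambda>n. h n / n) \<longlonglongrightarrow> L"
  proof (rule order_tendstoI)
    fix a assume "a < L"
    have "(\<lambda>n. L - D * real n powr (\<beta> - 1)) \<longlonglongrightarrow> L - D * 0"
      by (intro tendsto_intros null)
    then have "\<forall>\<^sub>F n in sequentially. a < L - D * real n powr (\<beta> - 1)"
      using \<open>a < L\<close> by (intro order_tendstoD(1)) auto
    then show "\<forall>\<^sub>F n in sequentially. a < h n / n"
      using eventually_gt_at_top[of 0]
    proof eventually_elim
      case (elim n)
      then show ?case using Lu[of n] by (simp add: u_def add_divide_distrib flip: pow)
    qed
  next
    fix a assume "L < a"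
    then have "\<exists>n\<in>{0<..}. u n < a" unfolding L_def
      using u by (subst (asm) cINF_less_iff) (auto intro: bdd_belowI[of _ 0])
    then obtain n0 where n0: "0 < n0" "u n0 < a" by auto
    \<comment> \<open>A bound for \<open>h\<close> at all remainders modulo \<open>n0\<close>, so
      that one further addition with its single error term reaches an arbitrary
      \<open>n\<close>.\<close>
    define H where "H = (\<Sum>r<n0. h r)"
    have "(\<lambda>n. u n0 + H / real n + C * real n powr (\<beta> - 1)) \<longlonglongrightarrow> u n0 + 0 + C * 0"
      by (intro tendsto_intros null tendsto_divide_0[OF tendsto_const] filterlim_at_top_imp_at_infinity
          filterlim_real_sequentially)
    then have "\<forall>\<^sub>F n in sequentially. u n0 + H / real n + C * real n powr (\<beta> - 1) < a"
      using n0 by (intro order_tendstoD(2)) auto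
    then show "\<forall>\<^sub>F n in sequentially. h n / n < a"
      using eventually_ge_at_top[of n0]
    proof eventually_elim
      case (elim n)
      define q r where "q = n div n0" and "r = n mod n0"
      have n: "n = q * n0 + r" "r < n0" "0 < q" "0 < n"
        using elim n0 by (auto simp: q_def r_def div_greater_zero_iff)
      have "h (q * n0) \<le> q * (h n0 + D * real n0 powr \<beta>)"
        using near_subadditive_multiple[OF sub C \<beta> D_def \<open>0 < q\<close> \<open>0 < n0\<close>] D
        by (smt (verit) mult_nonneg_nonneg powr_ge_zero)
      also have "\<dots> = real (q * n0) * u n0" using n0 by (simp add: u_def)
      also have "\<dots> \<le> real n * u n0" using u n(1) by (intro mult_right_mono) (simp_all flip: of_nat_mult)
      finally have 1: "h (q * n0) \<le> real n * u n0" .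
      have "h r \<le> H" unfolding H_def using n nonneg by (intro member_le_sum) auto
      moreover have "h n \<le> h (q * n0) + h r + C * real n powr \<beta>"
        using sub[of "q * n0" r] n n0 nonneg[of 0] C by (cases "r = 0") auto
      ultimately have "h n \<le> real n * u n0 + H + C * real n powr \<beta>" using 1 by simp
      then have "h n / n \<le> (real n * u n0 + H + C * real n powr \<beta>) / n"
        by (intro divide_right_mono) auto
      also have "\<dots> = u n0 + H / n + C * real n powr (\<beta> - 1)"
        unfolding pow[symmetric] using n(4) by (simp add: add_divide_distrib)
      finally show ?case using elim by simp
    qed
  qed
qed

text \<open>Insert \<open>us @ vs\<close> on both sides and regroup: what has been transported from
  \<open>us\<close> to \<open>vs\<close> is sent back. With boundary points this undoes a
  charge.\<close>

lemma assignment_cost_le_add_append: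
  assumes "length xs = length ys" "length us = length vs" "0 < \<alpha>" "\<alpha> \<le> 1"
  shows "assignment_cost \<alpha> xs ys \<le> assignment_cost \<alpha> (xs @ us) (ys @ vs) + assignment_cost \<alpha> vs us"
proof -
  have "assignment_cost \<alpha> xs ys \<le> assignment_cost \<alpha> ((us @ vs) @ xs) ((us @ vs) @ ys)"
    using assms by (intro assignment_cost_cancel) auto
  also have "\<dots> = assignment_cost \<alpha> ((xs @ us) @ vs) ((ys @ vs) @ us)"
    using assms by (intro assignment_cost_mset_cong) auto
  also have "\<dots> \<le> assignment_cost \<alpha> (xs @ us) (ys @ vs) + assignment_cost \<alpha> vs us"
    using assms by (intro assignment_cost_append) auto
  finally show ?thesis .
qed

lemma charged_cost_0_le:
  assumes "length zs = 2 * n" "0 < \<alpha>" "\<alpha> \<le> 1"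
  shows "charged_cost \<alpha> 0 0 n zs \<le> charged_cost \<alpha> p q n zs + (p + q)"
proof -
  let ?u = "replicate p (0::real) @ replicate q 1" and ?v = "replicate p (1::real) @ replicate q 0"
  have "assignment_cost \<alpha> ?v ?u \<le> assignment_cost \<alpha> (replicate p 1) (replicate p 0)
      + assignment_cost \<alpha> (replicate q 0) (replicate q 1)"
    by (intro assignment_cost_append) auto
  also have "\<dots> \<le> real p + real q"
    using assms by (intro add_mono assignment_cost_replicate_le) auto
  finally have "assignment_cost \<alpha> ?v ?u \<le> real (p + q)" by simp
  then show ?thesis
    using assignment_cost_le_add_append[of "take n zs" "drop n zs" ?u ?v \<alpha>] assms
    by (simp add: charged_cost_def)
qed

text \<open>The surplus \<open>r\<close> is sent back across the interval at a cost of at most 1 per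
  unit. This allows a charge to be rounded down to a grid.\<close>

lemma charged_cost_add_ge:
  assumes "length zs = 2 * n" "0 < \<alpha>" "\<alpha> \<le> 1"
  shows "charged_cost \<alpha> p 0 n zs \<le> charged_cost \<alpha> (p + r) 0 n zs + r"
    and "charged_cost \<alpha> 0 p n zs \<le> charged_cost \<alpha> 0 (p + r) n zs + r"
proof -
  have *: "assignment_cost \<alpha> (take n zs @ replicate p a) (drop n zs @ replicate p b) \<le>
    assignment_cost \<alpha> (take n zs @ replicate (p + r) a) (drop n zs @ replicate (p + r) b) + r"
    if "\<bar>a - b\<bar> = 1" for a b :: real
    using assignment_cost_le_add_append[of "take n zs @ replicate p a" "drop n zs @ replicate p b"
        "replicate r a" "replicate r b" \<alpha>] assignment_cost_replicate_le[of b a \<alpha> r] assms that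
    by (simp add: replicate_add abs_minus_commute)
  show "charged_cost \<alpha> p 0 n zs \<le> charged_cost \<alpha> (p + r) 0 n zs + r"
    "charged_cost \<alpha> 0 p n zs \<le> charged_cost \<alpha> 0 (p + r) n zs + r"
    using *[of 0 1] *[of 1 0] by (simp_all add: charged_cost_def)
qed

text \<open>Here the sample is undone instead of the charge, at the price of its uncharged cost; the
  pure charge that is left costs \<open>p\<close>.\<close>

lemma charged_cost_ge_charge:
  assumes "length zs = 2 * n" "0 < \<alpha>" "\<alpha> \<le> 1"
  shows "p - charged_cost \<alpha> 0 0 n zs \<le> charged_cost \<alpha> p 0 n zs"
    and "p - charged_cost \<alpha> 0 0 n zs \<le> charged_cost \<alpha> 0 p n zs"
proof -
  have *: "p - assignment_cost \<alpha> (take n zs) (drop n zs) \<le>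
    assignment_cost \<alpha> (take n zs @ replicate p a) (drop n zs @ replicate p b)"
    if "\<bar>a - b\<bar> = 1" for a b :: real
  proof -
    have "p \<le> assignment_cost \<alpha> (replicate p a) (replicate p b)"
      using that by (rule assignment_cost_replicate_ge)
    also have "\<dots> \<le> assignment_cost \<alpha> (replicate p a @ take n zs) (replicate p b @ drop n zs)
        + assignment_cost \<alpha> (drop n zs) (take n zs)"
      using assms by (intro assignment_cost_le_add_append) auto
    also have "assignment_cost \<alpha> (replicate p a @ take n zs) (replicate p b @ drop n zs) =
      assignment_cost \<alpha> (take n zs @ replicate p a) (drop n zs @ replicate p b)"
      using assms by (intro assignment_cost_mset_cong) auto
    also have "assignment_cost \<alpha> (drop n zs) (take n zs) = assignment_cost \<alpha> (take n zs) (drop n zs)"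
      using assms by (intro assignment_cost_commute) auto
    finally show ?thesis by simp
  qed
  show "p - charged_cost \<alpha> 0 0 n zs \<le> charged_cost \<alpha> p 0 n zs"
    "p - charged_cost \<alpha> 0 0 n zs \<le> charged_cost \<alpha> 0 p n zs"
    using *[of 0 1] *[of 1 0] by (simp_all add: charged_cost_def)
qed

lemma charged_mean_0_le:
  assumes \<alpha>: "0 < \<alpha>" "\<alpha> \<le> 1"
  shows "charged_mean \<alpha> 0 0 n \<le> charged_mean \<alpha> p q n + (p + q)"
proof -
  have ids: "list_all unit_contraction (replicate k (\<lambda>x. x))" for k by (simp add: list_all_length)
  note F = coord_hoelder_charged_cost[OF \<alpha>]
  show ?thesis unfolding charged_mean_def
    using charged_cost_0_le[OF _ \<alpha>]
    by (intro unif_mean_mono_maps[OF F F ids _ ids]) (auto simp: \<alpha>)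
qed

lemma charged_mean_nonneg:
  assumes \<alpha>: "0 < \<alpha>" "\<alpha> \<le> 1"
  shows "0 \<le> charged_mean \<alpha> p q n"
proof -
  have ids: "list_all unit_contraction (replicate k (\<lambda>x. x))" for k by (simp add: list_all_length)
  have "iid_mean (2 * n) (\<lambda>_. 0) \<le> charged_mean \<alpha> p q n" unfolding charged_mean_def
    by (rule unif_mean_mono[OF coord_hoelder_const coord_hoelder_charged_cost[OF \<alpha>] ids])
      (auto simp: charged_cost_def \<alpha> intro!: assignment_cost_nonneg)
  then show ?thesis by simp
qed

section \<open>Existence of the limit and its uniform lower bound\<close>

lemma scaled_charged_mean_near_subadditive:
  assumes "0 < m" "0 < n" and \<alpha>: "0 < \<alpha>" "\<alpha> \<le> 1"
  shows "real (m + n) powr \<alpha> * charged_mean \<alpha> p q (m + n) \<le>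
    real m powr \<alpha> * charged_mean \<alpha> p q m + real n powr \<alpha> * charged_mean \<alpha> p q n
    + 2 * real (m + n) powr (\<alpha> + 1 / 2)"
proof -
  let ?s = "real (m + n)"
  have s: "?s > 0" using assms by simp
  have "?s powr \<alpha> * charged_mean \<alpha> p q (m + n) \<le> ?s powr \<alpha> *
    ((m / ?s) powr \<alpha> * charged_mean \<alpha> p q m + (n / ?s) powr \<alpha> * charged_mean \<alpha> p q n + 2 * sqrt ?s)"
    using charged_mean_split[OF assms] by (intro mult_left_mono) auto
  also have "\<dots> = real m powr \<alpha> * charged_mean \<alpha> p q m + real n powr \<alpha> * charged_mean \<alpha> p q n
    + 2 * (?s powr \<alpha> * sqrt ?s)"
    using s by (simp add: distrib_left powr_divide)
  also have "?s powr \<alpha> * sqrt ?s = ?s powr (\<alpha> + 1 / 2)"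
    using s by (simp add: powr_add powr_half_sqrt)
  finally show ?thesis .
qed

text \<open>\<open>D\<close> is fixed before \<open>p\<close>, \<open>q\<close> and
  \<open>n\<close>, because the error constant 2 of near-subadditivity is the same for every charge.
  With \<open>p\<close>, \<open>q\<close>, \<open>n\<close> fixed, the bound is read at
  \<open>k * n\<close> for growing \<open>k\<close>, where the price \<open>p + q\<close> of
  dropping the charge is negligible.\<close>

lemma charged_mean_limit:
  assumes \<alpha>: "0 < \<alpha>" "\<alpha> < 1 / 2"
  obtains L D where "(\<lambda>n. real n powr (\<alpha> - 1) * charged_mean \<alpha> 0 0 n) \<longlonglongrightarrow> L"
    and "\<And>p q n. 0 < n \<Longrightarrow> L - D * real n powr (\<alpha> - 1 / 2) \<le> real n powr (\<alpha> - 1) * charged_mean \<alpha> p q n"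
proof -
  let ?h = "\<lambda>p q n. real n powr \<alpha> * charged_mean \<alpha> p q n"
  define \<beta> where "\<beta> = \<alpha> + 1 / 2"
  have \<beta>: "\<beta> < 1" and \<alpha>1: "\<alpha> \<le> 1" using \<alpha> by (simp_all add: \<beta>_def)
  note sub = scaled_charged_mean_near_subadditive[OF _ _ \<alpha>(1) \<alpha>1, folded \<beta>_def]
  have pow: "real n powr \<alpha> * c / n = real n powr (\<alpha> - 1) * c" for n c
    by (cases "n = 0") (simp_all add: powr_diff)
  obtain L where "(\<lambda>n. ?h 0 0 n / n) \<longlonglongrightarrow> L"
    using near_subadditive_convergent[OF sub[where p = 0 and q = 0] _ \<beta>] charged_mean_nonneg[OF \<alpha>(1) \<alpha>1] by auto
  then have L: "(\<lambda>n. real n powr (\<alpha> - 1) * charged_mean \<alpha> 0 0 n) \<longlonglongrightarrow> L"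
    by (simp add: pow)
  define D where "D = 2 / ((3 / 2) powr (1 - \<beta>) - 1)"
  have "1 < (3 / 2 :: real) powr (1 - \<beta>)" using \<beta> by simp
  then have D: "0 \<le> D" by (simp add: D_def)
  show ?thesis
  proof (rule that[OF L])
    fix p q n :: nat assume n: "0 < n"
    let ?v = "real n powr (\<alpha> - 1) * charged_mean \<alpha> p q n + D * real n powr (\<alpha> - 1 / 2)"
    have mult: "filterlim (\<lambda>k. k * n) sequentially sequentially"
      using n by (intro filterlim_subseq strict_monoI) auto
    have "(\<lambda>N. real N powr (\<alpha> - 1)) \<longlonglongrightarrow> 0"
      using \<alpha> by (intro tendsto_neg_powr filterlim_real_sequentially) auto
    then have "(\<lambda>N. real N powr (\<alpha> - 1) * charged_mean \<alpha> 0 0 N - (p + q) * real N powr (\<alpha> - 1))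
        \<longlonglongrightarrow> L - real (p + q) * 0"
      by (intro tendsto_intros L)
    from filterlim_compose[OF this mult]
    have "(\<lambda>k. real (k * n) powr (\<alpha> - 1) * charged_mean \<alpha> 0 0 (k * n) - (p + q) * real (k * n) powr (\<alpha> - 1))
        \<longlonglongrightarrow> L" by simp
    moreover have "real (k * n) powr (\<alpha> - 1) * charged_mean \<alpha> 0 0 (k * n) - (p + q) * real (k * n) powr (\<alpha> - 1) \<le> ?v"
      if k: "0 < k" for k
    proof -
      have "real (k * n) powr (\<alpha> - 1) * charged_mean \<alpha> 0 0 (k * n) \<le>
        real (k * n) powr (\<alpha> - 1) * (charged_mean \<alpha> p q (k * n) + real (p + q))"
        using charged_mean_0_le[OF \<alpha>(1) \<alpha>1] by (intro mult_left_mono) auto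
      then have "real (k * n) powr (\<alpha> - 1) * charged_mean \<alpha> 0 0 (k * n) - (p + q) * real (k * n) powr (\<alpha> - 1)
        \<le> real (k * n) powr (\<alpha> - 1) * charged_mean \<alpha> p q (k * n)"
        by (simp only: distrib_left) (simp add: mult.commute)
      also have "\<dots> = ?h p q (k * n) / real (k * n)" by (rule pow[symmetric])
      also have "\<dots> \<le> (k * (?h p q n + D * real n powr \<beta>)) / real (k * n)"
      proof (rule divide_right_mono)
        show "?h p q (k * n) \<le> k * (?h p q n + D * real n powr \<beta>)"
          using near_subadditive_multiple[OF sub[where p = p and q = q] _ \<beta> D_def k n]
            mult_nonneg_nonneg[OF D powr_ge_zero[of "real (k * n)" \<beta>]] by linarith
      qed simp
      also have "\<dots> = ?h p q n / n + D * (real n powr \<beta> * 1 / n)"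
        using k n by (simp add: add_divide_distrib)
      also have "real n powr \<beta> * 1 / n = real n powr (\<alpha> - 1 / 2)"
      proof -
        have "real n powr \<beta> * 1 / n = real n powr (\<beta> - 1)" using n by (simp add: powr_diff)
        then show ?thesis by (simp add: \<beta>_def)
      qed
      finally show ?thesis by (simp only: pow)
    qed
    ultimately have "L \<le> ?v"
      by (intro LIMSEQ_le_const2[where X = "\<lambda>k. real (k * n) powr (\<alpha> - 1) * charged_mean \<alpha> 0 0 (k * n)
            - (p + q) * real (k * n) powr (\<alpha> - 1)"]) (auto intro!: exI[of _ 1])
    then show "L - D * real n powr (\<alpha> - 1 / 2) \<le> real n powr (\<alpha> - 1) * charged_mean \<alpha> p q n" by simp
  qed
qed

section \<open>Expectations as iterated means\<close>

text \<open>Rounding the coordinates down to multiples of 1 / (k + 1) factors \<open>F\<close>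
  through the countable type of integer lists, where every function is measurable; the Hoelder bound
  gives pointwise convergence as \<open>k\<close> grows.\<close>

lemma measurable_coord_hoelder:
  assumes F: "coord_hoelder \<alpha> UNIV K N F" and "0 < \<alpha>" "0 \<le> K"
  shows "(\<lambda>z. F (map z [0..<N])) \<in> borel_measurable (\<Pi>\<^sub>M i\<in>{..<N}. borel)"
proof (rule borel_measurable_LIMSEQ_real)
  let ?P = "\<Pi>\<^sub>M i\<in>{..<N}. (borel :: real measure)"
  let ?d = "\<lambda>k x. real_of_int \<lfloor>x * real (Suc k)\<rfloor> / real (Suc k)"
  show "(\<lambda>z. F (map (\<lambda>i. ?d k (z i)) [0..<N])) \<in> borel_measurable ?P" for k
  proof -
    have "(\<lambda>z. map (\<lambda>i. \<lfloor>z i * real (Suc k)\<rfloor>) [0..<N]) \<in> measurable ?P (count_space UNIV)"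
      unfolding measurable_count_space_eq2_countable
    proof (intro conjI ballI)
      fix l :: "int list"
      have meas: "(\<lambda>z. \<lfloor>z i * real (Suc k)\<rfloor>) \<in> measurable ?P (count_space UNIV)" if "i \<in> {..<N}" for i
        using measurable_component_singleton[OF that, of "\<lambda>_. borel :: real measure"] by measurable
      have "(\<lambda>z. map (\<lambda>i. \<lfloor>z i * real (Suc k)\<rfloor>) [0..<N]) -` {l} \<inter> space ?P =
        (if length l = N then {z \<in> space ?P. \<forall>i\<in>{..<N}. \<lfloor>z i * real (Suc k)\<rfloor> = l ! i} else {})"
      proof -
        have "map g [0..<N] = l \<longleftrightarrow> length l = N \<and> (\<forall>i\<in>{..<N}. g i = l ! i)" for g
          by (auto simp: list_eq_iff_nth_eq)
        then show ?thesis by (simp only: vimage_def Int_def singleton_iff) auto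
      qed
      also have "\<dots> \<in> sets ?P"
      proof -
        have "{z \<in> space ?P. \<lfloor>z i * real (Suc k)\<rfloor> = l ! i} \<in> sets ?P" if "i \<in> {..<N}" for i
          using measurable_sets[OF meas[OF that], of "{l ! i}"] by (simp add: vimage_def Int_def conj_commute)
        then show ?thesis by (auto intro: sets.sets_Collect_finite_All)
      qed
      finally show "(\<lambda>z. map (\<lambda>i. \<lfloor>z i * real (Suc k)\<rfloor>) [0..<N]) -` {l} \<inter> space ?P \<in> sets ?P" .
    qed simp
    from measurable_compose[OF this, of "\<lambda>l. F (map (\<lambda>j. real_of_int j / real (Suc k)) l)" borel]
    show ?thesis by (simp add: comp_def)
  qed
  fix z :: "nat \<Rightarrow> real"
  show "(\<lambda>k. F (map (\<lambda>i. ?d k (z i)) [0..<N])) \<longlonglongrightarrow> F (map z [0..<N])"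
  proof (rule LIM_zero_cancel, rule Lim_null_comparison)
    have "\<bar>F (map (\<lambda>i. ?d k (z i)) [0..<N]) - F (map z [0..<N])\<bar> \<le> K * N * (1 / real (Suc k)) powr \<alpha>" for k
    proof (rule coord_hoelder_diff_le[OF assms])
      have "\<bar>?d k x - x\<bar> \<le> 1 / real (Suc k)" for x
      proof -
        have "?d k x - x = (real_of_int \<lfloor>x * real (Suc k)\<rfloor> - x * real (Suc k)) / real (Suc k)"
          by (simp add: field_simps)
        moreover have "\<bar>real_of_int \<lfloor>x * real (Suc k)\<rfloor> - x * real (Suc k)\<bar> \<le> 1" by linarith
        ultimately show ?thesis by (simp add: abs_divide divide_right_mono)
      qed
      then show "list_all2 (\<lambda>x y. \<bar>x - y\<bar> \<le> 1 / real (Suc k)) (map (\<lambda>i. ?d k (z i)) [0..<N]) (map z [0..<N])"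
        by (simp add: list_all2_conv_all_nth)
    qed auto
    then show "\<forall>\<^sub>F k in sequentially. norm (F (map (\<lambda>i. ?d k (z i)) [0..<N]) - F (map z [0..<N]))
        \<le> K * N * (1 / real (Suc k)) powr \<alpha>" by simp
    have "(\<lambda>k. 1 / real (Suc k)) \<longlonglongrightarrow> 0" using LIMSEQ_inverse_real_of_nat by (simp add: inverse_eq_divide)
    then have "(\<lambda>k. K * N * (1 / real (Suc k)) powr \<alpha>) \<longlonglongrightarrow> K * N * 0"
      using \<open>0 < \<alpha>\<close>
      by (intro tendsto_mult tendsto_const tendsto_zero_powrI[where b = \<alpha>]) auto
    then show "(\<lambda>k. K * N * (1 / real (Suc k)) powr \<alpha>) \<longlonglongrightarrow> 0" by simp
  qed
qed

abbreviation (input) unit_uniform :: "real measure" where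
  "unit_uniform \<equiv> uniform_measure lborel {0..1}"

lemma prob_space_unit_uniform: "prob_space unit_uniform"
  by (rule prob_space_uniform_measure) auto

lemma integral_unit_uniform:
  fixes f :: "real \<Rightarrow> real"
  assumes f: "continuous_on UNIV f"
  shows "(\<integral>x. f x \<partial>unit_uniform) = integral {0..1} f"
proof -
  have [measurable]: "f \<in> borel_measurable borel" using f by (rule borel_measurable_continuous_onI)
  have eq: "unit_uniform = density lborel (\<lambda>x. ennreal (indicator {0..1} x))"
    unfolding uniform_measure_def by (simp add: ennreal_indicator divide_ennreal_def)
  have "(\<integral>x. f x \<partial>unit_uniform) = (LINT x : {0..1} | lborel. f x)"
    unfolding eq set_lebesgue_integral_def by (subst integral_density) auto
  also have "\<dots> = integral {0..1} f"
    using f by (intro set_borel_integral_eq_integral borel_integrable_atLeastAtMost')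
      (auto intro: continuous_on_subset)
  finally show ?thesis .
qed

text \<open>Enlarging the index set \<open>{..<N}\<close> adds a last coordinate, so Fubini's
  theorem integrates the end of the list, whereas \<open>unif_mean\<close> integrates its head. For
  equal maps the two orders are reconciled by \<open>unif_mean_append\<close>. The bound
  \<open>B\<close> ensures integrability.\<close>

lemma integral_PiM_eq_iid_mean_bounded:
  assumes F: "coord_hoelder \<alpha> UNIV K N F" and \<alpha>: "0 < \<alpha>" and K: "0 \<le> K"
    and bound: "\<And>xs. length xs = N \<Longrightarrow> \<bar>F xs\<bar> \<le> B"
  shows "(\<integral>z. F (map z [0..<N]) \<partial>(\<Pi>\<^sub>M i\<in>{..<N}. unit_uniform)) = iid_mean N F"
  using F bound
proof (induction N arbitrary: F)
  case 0
  interpret prob_space "\<Pi>\<^sub>M i\<in>{..<0::nat}. unit_uniform"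
    by (intro prob_space_PiM prob_space_unit_uniform)
  show ?case using prob_space by simp
next
  case (Suc N)
  let ?P = "\<lambda>N. \<Pi>\<^sub>M i\<in>{..<N}. unit_uniform"
  interpret U: prob_space unit_uniform by (rule prob_space_unit_uniform)
  interpret product_sigma_finite "\<lambda>_::nat. unit_uniform" by unfold_locales
  interpret P: prob_space "?P (Suc N)"
    by (intro prob_space_PiM prob_space_unit_uniform)
  have cont: "continuous_on S (\<lambda>y. F (xs @ [y]))" if "length xs = N" for xs S
    using coord_hoelderD[OF Suc.prems(1), of xs _ "[]"] that
    by (intro continuous_on_hoelder[OF _ \<alpha>, where K = K]) auto
  have "sets (?P (Suc N)) = sets (\<Pi>\<^sub>M i\<in>{..<Suc N}. borel)" by (intro sets_PiM_cong) auto
  then have meas: "(\<lambda>z. F (map z [0..<Suc N])) \<in> borel_measurable (?P (Suc N))"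
    using measurable_coord_hoelder[OF Suc.prems(1) \<alpha> K] by (simp cong: measurable_cong_sets)
  have int: "integrable (?P (Suc N)) (\<lambda>z. F (map z [0..<Suc N]))"
    using Suc.prems(2) by (intro P.integrable_const_bound[where B = B] meas AE_I2) auto
  define G where "G xs = integral {0..1} (\<lambda>y. F (xs @ [y]))" for xs
  have G: "coord_hoelder \<alpha> UNIV K N G"
  proof (rule coord_hoelderI)
    fix xs ys :: "real list" and x x' :: real assume len: "length (xs @ x # ys) = N"
    have c: "continuous_on {0..1} (\<lambda>y. F (xs @ z # ys @ [y]))" for z
      using cont[of "xs @ z # ys"] len by simp
    have "\<bar>integral {0..1} (\<lambda>y. F (xs @ x # ys @ [y]) - F (xs @ x' # ys @ [y]))\<bar>
      \<le> integral {0..1} (\<lambda>_::real. K * \<bar>x - x'\<bar> powr \<alpha>)"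
      unfolding real_norm_def[symmetric]
    proof (rule integral_norm_bound_integral)
      show "norm (F (xs @ x # ys @ [y]) - F (xs @ x' # ys @ [y])) \<le> K * norm (x - x') powr \<alpha>" for y
        using coord_hoelderD[OF Suc.prems(1), of xs x "ys @ [y]" x'] len by simp
    qed (intro integrable_continuous_interval continuous_intros c)+
    moreover have "integral {0..1} (\<lambda>y. F (xs @ x # ys @ [y]) - F (xs @ x' # ys @ [y])) =
      G (xs @ x # ys) - G (xs @ x' # ys)"
      unfolding G_def append.assoc append_Cons
      by (intro integral_diff integrable_continuous_interval c)
    ultimately show "\<bar>G (xs @ x # ys) - G (xs @ x' # ys)\<bar> \<le> K * \<bar>x - x'\<bar> powr \<alpha>" by simp
  qed
  have GB: "\<bar>G xs\<bar> \<le> B" if "length xs = N" for xs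
  proof -
    have "norm (G xs) \<le> integral {0..1} (\<lambda>_::real. B)"
      unfolding G_def using Suc.prems(2) that
      by (intro integral_norm_bound_integral integrable_continuous_interval cont) auto
    then show ?thesis by simp
  qed
  have "{..<Suc N} = insert N {..<N}" by auto
  then have "(\<integral>z. F (map z [0..<Suc N]) \<partial>?P (Suc N)) =
    (\<integral>z. \<integral>y. F (map (z(N := y)) [0..<Suc N]) \<partial>unit_uniform \<partial>?P N)"
    using product_integral_insert[of "{..<N}" N "\<lambda>z. F (map z [0..<Suc N])"] int by simp
  also have "\<dots> = (\<integral>z. G (map z [0..<N]) \<partial>?P N)"
  proof (intro Bochner_Integration.integral_cong refl)
    fix z :: "nat \<Rightarrow> real"
    have "map (z(N := y)) [0..<Suc N] = map z [0..<N] @ [y]" for y by simp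
    then show "(\<integral>y. F (map (z(N := y)) [0..<Suc N]) \<partial>unit_uniform) = G (map z [0..<N])"
      unfolding G_def by (simp only:) (intro integral_unit_uniform cont, simp)
  qed
  also have "\<dots> = iid_mean N G" by (rule Suc.IH[OF G GB])
  also have "\<dots> = iid_mean (Suc N) F"
    unfolding replicate_Suc replicate_append_same[symmetric] unif_mean_append by (simp add: G_def[abs_def])
  finally show ?case .
qed

text \<open>Injectivity lets events indexed by \<open>J\<close> be regarded as events indexed by its
  image, where independence is given.\<close>

lemma (in prob_space) indep_vars_reindex:
  assumes ind: "indep_vars M' X (f ` I)" and f: "inj_on f I"
  shows "indep_vars (\<lambda>i. M' (f i)) (\<lambda>i. X (f i)) I"
  unfolding indep_vars_def2
proof (intro conjI ballI)
  fix i assume "i \<in> I"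
  then show "random_variable (M' (f i)) (X (f i))" using ind by (auto simp: indep_vars_def2)
next
  let ?F = "\<lambda>k. {X k -` A \<inter> space M |A. A \<in> sets (M' k)}"
  have F: "indep_sets ?F (f ` I)" using ind by (simp add: indep_vars_def2)
  show "indep_sets (\<lambda>i. ?F (f i)) I"
  proof (rule indep_setsI)
    show "?F (f i) \<subseteq> events" if "i \<in> I" for i
      using F that by (auto simp: indep_sets_def)
    fix A J assume J: "J \<noteq> {}" "J \<subseteq> I" "finite J" "\<forall>j\<in>J. A j \<in> ?F (f j)"
    have inj: "inj_on f J" using f J(2) by (rule inj_on_subset)
    let ?A = "\<lambda>k. A (the_inv_into J f k)"
    have "prob (\<Inter>k\<in>f ` J. ?A k) = (\<Prod>k\<in>f ` J. prob (?A k))"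
      using J by (intro indep_setsD[OF F]) (auto simp: the_inv_into_f_f[OF inj])
    then show "prob (\<Inter>j\<in>J. A j) = (\<Prod>j\<in>J. prob (A j))"
      by (simp add: prod.reindex[OF inj] the_inv_into_f_f[OF inj] cong: INF_cong_simp prod.cong)
  qed
qed

text \<open>\<open>F\<close> may be unbounded on the whole line. Composing it with the clipping of
  coordinates to [0, 1] gives a bounded function with the same Hoelder bound, almost surely the same
  values on the sample, and the same iterated mean.\<close>

lemma (in prob_space) expectation_eq_iid_mean:
  fixes Z :: "nat \<Rightarrow> 'a \<Rightarrow> real"
  assumes F: "coord_hoelder \<alpha> UNIV K N F" and \<alpha>: "0 < \<alpha>" and K: "0 \<le> K"
    and ind: "indep_vars (\<lambda>_. borel) Z {..<N}"
    and unif: "\<And>i. i < N \<Longrightarrow> distr M borel (Z i) = unit_uniform"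
  shows "expectation (\<lambda>\<omega>. F (map (\<lambda>i. Z i \<omega>) [0..<N])) = iid_mean N F"
proof (cases "N = 0")
  case True
  then show ?thesis using prob_space by simp
next
  case False
  define clip :: "real \<Rightarrow> real" where "clip x = max 0 (min 1 x)" for x
  have clip: "0 \<le> clip x" "clip x \<le> 1" "\<bar>clip x - clip y\<bar> \<le> \<bar>x - y\<bar>" for x y
    by (auto simp: clip_def)
  have clip_id: "map clip xs = xs" if "set xs \<subseteq> {0..1}" for xs
    using that by (intro map_idI) (auto simp: clip_def)
  define G where "G xs = F (map clip xs)" for xs
  have G: "coord_hoelder \<alpha> UNIV K N G"
  proof (rule coord_hoelderI)
    fix xs ys :: "real list" and x x' :: real assume "length (xs @ x # ys) = N"
    then have "\<bar>G (xs @ x # ys) - G (xs @ x' # ys)\<bar> \<le> K * \<bar>clip x - clip x'\<bar> powr \<alpha>"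
      using coord_hoelderD[OF F, of "map clip xs" "clip x" "map clip ys" "clip x'"] by (simp add: G_def)
    also have "\<dots> \<le> K * \<bar>x - x'\<bar> powr \<alpha>"
      using clip K \<alpha> by (intro mult_left_mono powr_mono2) auto
    finally show "\<bar>G (xs @ x # ys) - G (xs @ x' # ys)\<bar> \<le> K * \<bar>x - x'\<bar> powr \<alpha>" .
  qed
  have bound: "\<bar>G xs\<bar> \<le> \<bar>F (replicate N 0)\<bar> + K * N" if "length xs = N" for xs
  proof -
    have "\<bar>F (map clip xs) - F (replicate N 0)\<bar> \<le> K * N * 1 powr \<alpha>"
      using that clip by (intro coord_hoelder_diff_le[OF F \<alpha> K]) (auto simp: list_all2_conv_all_nth)
    then show ?thesis by (simp add: G_def)
  qed
  let ?P = "\<Pi>\<^sub>M i\<in>{..<N}. (borel :: real measure)"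
  let ?Z = "\<lambda>\<omega>. \<lambda>i\<in>{..<N}. Z i \<omega>"
  have rv: "random_variable borel (Z i)" if "i < N" for i
    using ind that by (auto simp: indep_vars_def2)
  have Z: "?Z \<in> measurable M ?P" using rv by (intro measurable_restrict) auto
  have map_Z: "map (?Z \<omega>) [0..<N] = map (\<lambda>i. Z i \<omega>) [0..<N]" for \<omega> by simp
  have meas: "(\<lambda>\<omega>. H (map (\<lambda>i. Z i \<omega>) [0..<N])) \<in> borel_measurable M"
    if "coord_hoelder \<alpha> UNIV K N H" for H
    using measurable_compose[OF Z measurable_coord_hoelder[OF that \<alpha> K]] unfolding map_Z .
  have AE1: "AE \<omega> in M. Z i \<omega> \<in> {0..1}" if "i < N" for i
  proof -
    have "AE x in distr M borel (Z i). x \<in> {0..1}"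
      unfolding unif[OF that] by (intro AE_uniform_measureI) auto
    then show ?thesis using rv[OF that] by (subst (asm) AE_distr_iff) auto
  qed
  have "AE \<omega> in M. \<forall>i\<in>{..<N}. Z i \<omega> \<in> {0..1}"
    using AE1 by (intro AE_finite_allI) auto
  then have AE: "AE \<omega> in M. F (map (\<lambda>i. Z i \<omega>) [0..<N]) = G (map (\<lambda>i. Z i \<omega>) [0..<N])"
  proof eventually_elim
    case (elim \<omega>)
    then have "map clip (map (\<lambda>i. Z i \<omega>) [0..<N]) = map (\<lambda>i. Z i \<omega>) [0..<N]"
      by (intro clip_id) auto
    then show ?case by (simp only: G_def)
  qed
  have distr: "distr M ?P ?Z = (\<Pi>\<^sub>M i\<in>{..<N}. unit_uniform)"
  proof -
    have "distr M ?P ?Z = (\<Pi>\<^sub>M i\<in>{..<N}. distr M borel (Z i))"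
      using ind rv False by (subst (asm) indep_vars_iff_distr_eq_PiM') auto
    also have "\<dots> = (\<Pi>\<^sub>M i\<in>{..<N}. unit_uniform)" using unif by (intro PiM_cong) auto
    finally show ?thesis .
  qed
  have "expectation (\<lambda>\<omega>. F (map (\<lambda>i. Z i \<omega>) [0..<N])) = expectation (\<lambda>\<omega>. G (map (\<lambda>i. Z i \<omega>) [0..<N]))"
    by (intro integral_cong_AE meas F G AE)
  also have "\<dots> = (\<integral>z. G (map z [0..<N]) \<partial>distr M ?P ?Z)"
    using integral_distr[OF Z measurable_coord_hoelder[OF G \<alpha> K]] unfolding map_Z by simp
  also have "\<dots> = iid_mean N G"
    unfolding distr by (rule integral_PiM_eq_iid_mean_bounded[OF G \<alpha> K bound])
  also have "\<dots> = iid_mean N F"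
    by (intro unif_mean_cong) (auto simp: list_all_length G_def clip_id)
  finally show ?thesis .
qed

section \<open>The boundary functional\<close>

lemma boundary_assignment_cost_le:
  assumes "length xs = length ys" "length xs' = length ys'" "set xs' \<subseteq> {0, 1}" "set ys' \<subseteq> {0, 1}"
  shows "boundary_assignment_cost \<alpha> xs ys \<le> assignment_cost \<alpha> (xs @ xs') (ys @ ys')"
  unfolding boundary_assignment_cost_def
proof (rule cInf_lower)
  show "bdd_below {assignment_cost \<alpha> (xs @ xs') (ys @ ys') | xs' ys'.
      length xs' = length ys' \<and> set xs' \<subseteq> {0, 1} \<and> set ys' \<subseteq> {0, 1}}"
    using assms(1) by (auto intro!: bdd_belowI[of _ 0] assignment_cost_nonneg)
qed (use assms in blast)

lemma boundary_assignment_cost_ge: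
  assumes "\<And>xs' ys'. length xs' = length ys' \<Longrightarrow> set xs' \<subseteq> {0, 1} \<Longrightarrow> set ys' \<subseteq> {0, 1} \<Longrightarrow>
      b \<le> assignment_cost \<alpha> (xs @ xs') (ys @ ys')"
  shows "b \<le> boundary_assignment_cost \<alpha> xs ys"
  unfolding boundary_assignment_cost_def
proof (rule cInf_greatest)
  show "{assignment_cost \<alpha> (xs @ xs') (ys @ ys') | xs' ys'.
      length xs' = length ys' \<and> set xs' \<subseteq> {0, 1} \<and> set ys' \<subseteq> {0, 1}} \<noteq> {}"
  proof -
    have "\<exists>xs' ys'. assignment_cost \<alpha> (xs @ []) (ys @ []) = assignment_cost \<alpha> (xs @ xs') (ys @ ys') \<and>
      length xs' = length ys' \<and> set xs' \<subseteq> {0, 1} \<and> set ys' \<subseteq> {0, 1}"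
      by (intro exI[of _ "[]"]) simp
    then show ?thesis by fast
  qed
next
  fix c assume "c \<in> {assignment_cost \<alpha> (xs @ xs') (ys @ ys') | xs' ys'.
      length xs' = length ys' \<and> set xs' \<subseteq> {0, 1} \<and> set ys' \<subseteq> {0, 1}}"
  then show "b \<le> c" using assms by auto
qed

abbreviation split_boundary_cost :: "real \<Rightarrow> nat \<Rightarrow> real list \<Rightarrow> real" where
  "split_boundary_cost \<alpha> n zs \<equiv> boundary_assignment_cost \<alpha> (take n zs) (drop n zs)"

text \<open>For each fixed choice of boundary points the cost has this modulus, and an infimum of
  functions with a common modulus inherits it.\<close>

lemma coord_hoelder_boundary_assignment_cost:
  assumes \<alpha>: "0 < \<alpha>" "\<alpha> \<le> 1"
  shows "coord_hoelder \<alpha> S 1 (2 * n) (split_boundary_cost \<alpha> n)"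
proof (rule coord_hoelderI)
  fix xs ys :: "real list" and x x' :: real
  assume len: "length (xs @ x # ys) = 2 * n"
  have *: "split_boundary_cost \<alpha> n (xs @ u # ys) - \<bar>u - v\<bar> powr \<alpha> \<le> split_boundary_cost \<alpha> n (xs @ v # ys)" for u v
  proof (rule boundary_assignment_cost_ge)
    fix us vs :: "real list" assume b: "length us = length vs" "set us \<subseteq> {0, 1}" "set vs \<subseteq> {0, 1}"
    have "split_boundary_cost \<alpha> n (xs @ u # ys)
        \<le> assignment_cost \<alpha> (take n (xs @ u # ys) @ us) (drop n (xs @ u # ys) @ vs)"
      using len b by (intro boundary_assignment_cost_le) auto
    moreover have "\<bar>assignment_cost \<alpha> (take n (xs @ u # ys) @ us) (drop n (xs @ u # ys) @ vs)
        - assignment_cost \<alpha> (take n (xs @ v # ys) @ us) (drop n (xs @ v # ys) @ vs)\<bar> \<le> 1 * \<bar>u - v\<bar> powr \<alpha>"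
      using coord_hoelderD[OF coord_hoelder_assignment_cost[OF b(1) \<alpha>], of xs u ys n UNIV v] len by simp
    ultimately show "split_boundary_cost \<alpha> n (xs @ u # ys) - \<bar>u - v\<bar> powr \<alpha>
        \<le> assignment_cost \<alpha> (take n (xs @ v # ys) @ us) (drop n (xs @ v # ys) @ vs)" by linarith
  qed
  show "\<bar>split_boundary_cost \<alpha> n (xs @ x # ys) - split_boundary_cost \<alpha> n (xs @ x' # ys)\<bar>
      \<le> 1 * \<bar>x - x'\<bar> powr \<alpha>"
    using *[of x x'] *[of x' x] by (simp add: abs_le_iff abs_minus_commute)
qed

lemma boundary_cost_le_charged_cost:
  assumes "length zs = 2 * n"
  shows "split_boundary_cost \<alpha> n zs \<le> charged_cost \<alpha> 0 0 n zs"
  using boundary_assignment_cost_le[of "take n zs" "drop n zs" "[]" "[]" \<alpha>] assms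
  by (simp add: charged_cost_def)

lemma mset_01_list:
  fixes us :: "real list"
  assumes "set us \<subseteq> {0, 1}"
  shows "mset us = replicate_mset (count_list us 0) 0 + replicate_mset (length us - count_list us 0) 1"
  using assms
proof (induction us)
  case (Cons u us)
  then show ?case using count_le_length[of us 0] by (auto simp: Suc_diff_le)
qed simp

lemma boundary_cost_ge_charged_cost:
  assumes "length zs = 2 * n" and \<alpha>: "0 < \<alpha>" "\<alpha> \<le> 1"
    and "\<And>p. b \<le> charged_cost \<alpha> p 0 n zs" "\<And>q. b \<le> charged_cost \<alpha> 0 q n zs"
  shows "b \<le> split_boundary_cost \<alpha> n zs"
proof (rule boundary_assignment_cost_ge)
  fix us vs :: "real list" assume uv: "length us = length vs" "set us \<subseteq> {0, 1}" "set vs \<subseteq> {0, 1}"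
  define k l m where "k = count_list us 0" and "l = count_list vs 0" and "m = length us"
  have kl: "k \<le> m" "l \<le> m" using uv count_le_length[of us 0] count_le_length[of vs 0]
    by (simp_all add: k_def l_def m_def)
  have us: "mset us = replicate_mset k 0 + replicate_mset (m - k) 1"
    and vs: "mset vs = replicate_mset l 0 + replicate_mset (m - l) 1"
    using uv mset_01_list[of us] mset_01_list[of vs] by (simp_all add: k_def l_def m_def)
  let ?C = "assignment_cost \<alpha> (take n zs @ us) (drop n zs @ vs)"
  define q p where "q = l - k" and "p = k - l"
  \<comment> \<open>The common points: both families contain at least \<open>min k l\<close> zeros
    and \<open>m - max k l\<close> ones. As subtraction of naturals is truncated, at most one of
    \<open>p\<close> and \<open>q\<close> is nonzero.\<close>
  define ws where "ws = replicate (min k l) 0 @ replicate (m - max k l) (1::real)"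
  have "charged_cost \<alpha> p q n zs \<le> assignment_cost \<alpha>
      (ws @ take n zs @ replicate p 0 @ replicate q 1) (ws @ drop n zs @ replicate p 1 @ replicate q 0)"
    unfolding charged_cost_def using assms by (intro assignment_cost_cancel) auto
  also have "\<dots> = ?C"
  proof (rule assignment_cost_mset_cong)
    have rep: "replicate_mset (a + b) x = replicate_mset a x + replicate_mset b x" for a b and x :: real
      by (induction a) auto
    have "k = min k l + p" "l = min k l + q" "m - k = m - max k l + q" "m - l = m - max k l + p"
      using kl by (auto simp: p_def q_def)
    then have "replicate_mset k x = replicate_mset (min k l) x + replicate_mset p x"
      "replicate_mset l x = replicate_mset (min k l) x + replicate_mset q x"
      "replicate_mset (m - k) x = replicate_mset (m - max k l) x + replicate_mset q x"
      "replicate_mset (m - l) x = replicate_mset (m - max k l) x + replicate_mset p x" for x :: real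
      by (metis rep)+
    then show "mset (ws @ take n zs @ replicate p 0 @ replicate q 1) = mset (take n zs @ us)"
      "mset (ws @ drop n zs @ replicate p 1 @ replicate q 0) = mset (drop n zs @ vs)"
      using us vs by (simp_all add: ws_def)
  qed (use assms in auto)
  finally have "charged_cost \<alpha> p q n zs \<le> ?C" .
  moreover have "p = 0 \<or> q = 0" by (auto simp: p_def q_def)
  ultimately show "b \<le> ?C" using assms(4)[of p] assms(5)[of q] by (elim disjE) auto
qed

section \<open>Lower bound through a grid of charges\<close>

definition charge_deviation :: "real \<Rightarrow> nat \<Rightarrow> nat \<Rightarrow> nat \<Rightarrow> real list \<Rightarrow> real" where
  "charge_deviation \<alpha> p q n zs = \<bar>charged_cost \<alpha> p q n zs - charged_mean \<alpha> p q n\<bar>"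

lemma coord_hoelder_charge_deviation:
  assumes "0 < \<alpha>" "\<alpha> \<le> 1"
  shows "coord_hoelder \<alpha> S 1 (2 * n) (charge_deviation \<alpha> p q n)"
  unfolding charge_deviation_def[abs_def]
  by (intro coord_hoelder_abs coord_hoelder_diff_const coord_hoelder_charged_cost assms)

text \<open>Charges that exceed \<open>2 f\<close>, \<open>f = \<close> \<^term>\<open>charged_mean \<alpha> 0 0 n\<close>, cost more than \<open>f\<close> by
  themselves; the smaller ones are within \<open>s\<close> of one of the \<open>J + 1\<close> multiples of \<open>s\<close>.\<close>

lemma boundary_cost_ge_deviations:
  assumes len: "length zs = 2 * n" and \<alpha>: "0 < \<alpha>" "\<alpha> \<le> 1" and s: "0 < s"
    and b: "\<And>p q. b \<le> charged_mean \<alpha> p q n"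
    and J: "2 * charged_mean \<alpha> 0 0 n \<le> real s * (real J + 1)"
  shows "b - s - (\<Sum>j\<le>J. charge_deviation \<alpha> (s * j) 0 n zs + charge_deviation \<alpha> 0 (s * j) n zs)
    \<le> split_boundary_cost \<alpha> n zs"
proof -
  let ?t = "\<lambda>j. charge_deviation \<alpha> (s * j) 0 n zs + charge_deviation \<alpha> 0 (s * j) n zs"
  \<comment> \<open>The sum dominates every single deviation and, unlike their maximum, its mean is
    computed by linearity.\<close>
  define R where "R = (\<Sum>j\<le>J. ?t j)"
  have nonneg: "0 \<le> charge_deviation \<alpha> p q n zs" for p q by (simp add: charge_deviation_def)
  have R: "charge_deviation \<alpha> (s * j) 0 n zs \<le> R" "charge_deviation \<alpha> 0 (s * j) n zs \<le> R" if "j \<le> J" for j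
  proof -
    have "?t j \<le> R" unfolding R_def using that nonneg by (intro member_le_sum) auto
    then show "charge_deviation \<alpha> (s * j) 0 n zs \<le> R" "charge_deviation \<alpha> 0 (s * j) n zs \<le> R"
      using nonneg[of "s * j" 0] nonneg[of 0 "s * j"] by linarith+
  qed
  \<comment> \<open>Stated for an abstract cost \<open>c\<close> of the charge, so that both
    directions of the charge are covered by one argument.\<close>
  have grid: "b - s - R \<le> c p"
    if le: "\<And>p r. c p \<le> c (p + r) + real r" and ge: "\<And>p. real p - charged_cost \<alpha> 0 0 n zs \<le> c p"
      and dev: "\<And>j. j \<le> J \<Longrightarrow> b - R \<le> c (s * j)" for c :: "nat \<Rightarrow> real" and p
  proof (cases "p div s \<le> J")
    case True
    have "c (s * (p div s)) \<le> c p + real (p mod s)" using le[of "s * (p div s)" "p mod s"] by simp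
    moreover have "p mod s \<le> s" using s by simp
    ultimately show ?thesis using dev[OF True] by linarith
  next
    case False
    \<comment> \<open>With f the uncharged mean, such a charge is at least 2 f. Its cost is then at
      least 2 f - (f + R) = f - R, and f is itself at least \<open>b\<close>.\<close>
    then have "s * (J + 1) \<le> s * (p div s)" by (intro mult_le_mono2) simp
    also have "\<dots> \<le> p" by simp
    finally have "real (s * (J + 1)) \<le> real p" by (rule of_nat_mono)
    then have "2 * charged_mean \<alpha> 0 0 n \<le> p" using J by (simp add: distrib_left)
    moreover have "charged_cost \<alpha> 0 0 n zs \<le> charged_mean \<alpha> 0 0 n + R"
      using R(1)[of 0] by (simp add: charge_deviation_def)
    ultimately show ?thesis using ge[of p] b[of 0 0] by linarith
  qed
  have dev: "b - R \<le> charged_cost \<alpha> (s * j) 0 n zs" "b - R \<le> charged_cost \<alpha> 0 (s * j) n zs" if "j \<le> J" for j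
    using R[OF that] b[of "s * j" 0] b[of 0 "s * j"] unfolding charge_deviation_def by linarith+
  show ?thesis unfolding R_def[symmetric]
    using grid[of "\<lambda>p. charged_cost \<alpha> p 0 n zs"] grid[of "\<lambda>p. charged_cost \<alpha> 0 p n zs"]
      charged_cost_add_ge[OF len \<alpha>] charged_cost_ge_charge[OF len \<alpha>] dev
    by (intro boundary_cost_ge_charged_cost[OF len \<alpha>]) auto
qed

text \<open>There are \<open>2 * (J + 1)\<close> deviations, one for each grid point and direction,
  and each has mean at most \<open>sqrt (2 * n)\<close> because 2 n coordinates are
  involved.\<close>

lemma boundary_mean_ge:
  fixes s J n :: nat and b :: real
  assumes \<alpha>: "0 < \<alpha>" "\<alpha> \<le> 1" and s: "0 < s"
    and b: "\<And>p q. b \<le> charged_mean \<alpha> p q n"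
    and J: "2 * charged_mean \<alpha> 0 0 n \<le> real s * (real J + 1)"
  shows "b - s - 2 * (J + 1) * sqrt (2 * n) \<le> iid_mean (2 * n) (split_boundary_cost \<alpha> n)"
proof -
  have ids: "list_all unit_contraction (replicate k (\<lambda>x. x))" for k by (simp add: list_all_length)
  let ?t = "\<lambda>j::nat. \<lambda>zs. charge_deviation \<alpha> (s * j) 0 n zs + charge_deviation \<alpha> 0 (s * j) n zs"
  note H = coord_hoelder_charge_deviation[OF \<alpha>]
  have t: "coord_hoelder \<alpha> {0..1} 2 (2 * n) (?t j)" for j
    using coord_hoelder_add[OF H[of _ n "s * j" 0] H[of _ n 0 "s * j"]] by simp
  note T = coord_hoelder_sum[OF t, of "{..J}"]
  have dev: "iid_mean (2 * n) (charge_deviation \<alpha> p q n) \<le> sqrt (2 * n)" for p q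
    using iid_mean_abs_deviation_le[OF coord_hoelder_charged_cost[OF \<alpha>] \<alpha>(1), of n p q]
    by (simp add: charge_deviation_def[abs_def] charged_mean_def)
  have "iid_mean (2 * n) (\<lambda>zs. \<Sum>j\<le>J. ?t j zs) = (\<Sum>j\<le>J. iid_mean (2 * n) (?t j))"
    using ids by (intro unif_mean_sum[OF _ t _ _ \<alpha>(1)]) auto
  also have "\<dots> = (\<Sum>j\<le>J. iid_mean (2 * n) (charge_deviation \<alpha> (s * j) 0 n)
      + iid_mean (2 * n) (charge_deviation \<alpha> 0 (s * j) n))"
    using ids by (intro sum.cong unif_mean_add[OF H H _ _ \<alpha>(1)]) auto
  also have "\<dots> \<le> (\<Sum>j\<le>J. sqrt (2 * n) + sqrt (2 * n))"
    by (intro sum_mono add_mono dev)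
  finally have sum: "iid_mean (2 * n) (\<lambda>zs. \<Sum>j\<le>J. ?t j zs) \<le> 2 * (J + 1) * sqrt (2 * n)"
    by (simp add: algebra_simps)
  have "iid_mean (2 * n) (\<lambda>_. b - s) \<le>
    iid_mean (2 * n) (\<lambda>zs. split_boundary_cost \<alpha> n zs + (\<Sum>j\<le>J. ?t j zs))"
    using boundary_cost_ge_deviations[OF _ \<alpha> s b J]
    by (intro unif_mean_mono[OF coord_hoelder_const
          coord_hoelder_add[OF coord_hoelder_boundary_assignment_cost[OF \<alpha>] T] ids _ \<alpha>(1)])
      (auto simp: algebra_simps)
  also have "\<dots> = iid_mean (2 * n) (split_boundary_cost \<alpha> n) + iid_mean (2 * n) (\<lambda>zs. \<Sum>j\<le>J. ?t j zs)"
    by (intro unif_mean_add[OF coord_hoelder_boundary_assignment_cost[OF \<alpha>] T ids _ \<alpha>(1)]) auto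
  finally show ?thesis using sum by simp
qed

lemma boundary_mean_le:
  assumes \<alpha>: "0 < \<alpha>" "\<alpha> \<le> 1"
  shows "iid_mean (2 * n) (split_boundary_cost \<alpha> n) \<le> charged_mean \<alpha> 0 0 n"
  unfolding charged_mean_def
  by (rule unif_mean_mono[OF coord_hoelder_boundary_assignment_cost[OF \<alpha>] coord_hoelder_charged_cost[OF \<alpha>]])
    (auto simp: list_all_length \<alpha> boundary_cost_le_charged_cost)

lemma boundary_mean_limit:
  assumes \<alpha>: "0 < \<alpha>" "\<alpha> < 1 / 2"
    and L: "(\<lambda>n. real n powr (\<alpha> - 1) * charged_mean \<alpha> 0 0 n) \<longlonglongrightarrow> L"
    and lower: "\<And>p q n. 0 < n \<Longrightarrow>
      L - D * real n powr (\<alpha> - 1 / 2) \<le> real n powr (\<alpha> - 1) * charged_mean \<alpha> p q n"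
  shows "(\<lambda>n. real n powr (\<alpha> - 1) * iid_mean (2 * n) (split_boundary_cost \<alpha> n)) \<longlonglongrightarrow> L"
proof (rule order_tendstoI)
  let ?b = "\<lambda>n. real n powr (\<alpha> - 1) * iid_mean (2 * n) (split_boundary_cost \<alpha> n)"
  have \<alpha>1: "\<alpha> \<le> 1" using \<alpha> by simp
  {
    fix a assume "L < a"
    with L have "\<forall>\<^sub>F n in sequentially. real n powr (\<alpha> - 1) * charged_mean \<alpha> 0 0 n < a"
      by (rule order_tendstoD)
    then show "\<forall>\<^sub>F n in sequentially. ?b n < a"
    proof eventually_elim
      case (elim n)
      have "?b n \<le> real n powr (\<alpha> - 1) * charged_mean \<alpha> 0 0 n"
        by (intro mult_left_mono boundary_mean_le \<alpha>(1) \<alpha>1) auto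
      with elim show ?case by simp
    qed
  next
    fix a assume "a < L"
    \<comment> \<open>Half of the gap between \<open>a\<close> and \<open>L\<close> is spent on the
      grid spacing; the other half absorbs the terms that tend to zero.\<close>
    define \<epsilon> where "\<epsilon> = (L - a) / 2"
    have \<epsilon>: "0 < \<epsilon>" "a < L - \<epsilon>" using \<open>a < L\<close> by (simp_all add: \<epsilon>_def field_simps)
    \<comment> \<open>Eventually the uncharged mean is below (L + 1) n^(1 - \<alpha>), so at spacing
      \<epsilon> n^(1 - \<alpha>) this \<open>J\<close>, which does not depend on \<open>n\<close>,
      reaches all relevant charges.\<close>
    obtain J :: nat where "2 * (L + 1) / \<epsilon> \<le> J" using real_arch_simple by blast
    then have J: "2 * (L + 1) \<le> \<epsilon> * (J + 1)" using \<epsilon> by (simp add: field_simps)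
    define s where "s n = nat \<lceil>\<epsilon> * real n powr (1 - \<alpha>)\<rceil>" for n
    have null: "(\<lambda>n. real n powr (\<alpha> - 1 / 2)) \<longlonglongrightarrow> 0" "(\<lambda>n. real n powr (\<alpha> - 1)) \<longlonglongrightarrow> 0"
      using \<alpha> by (intro tendsto_neg_powr filterlim_real_sequentially; simp)+
    \<comment> \<open>The losses after scaling are, in this order, the one in \<open>lower\<close>,
      the spacing together with rounding \<open>s n\<close> up to an integer, and the mean
      deviations of order \<open>sqrt n\<close>.\<close>
    have "(\<lambda>n. L - D * real n powr (\<alpha> - 1 / 2) - (\<epsilon> + real n powr (\<alpha> - 1))
        - 2 * (real J + 1) * sqrt 2 * real n powr (\<alpha> - 1 / 2)) \<longlonglongrightarrow>
        L - D * 0 - (\<epsilon> + 0) - 2 * (real J + 1) * sqrt 2 * 0"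
      by (intro tendsto_intros null)
    then have "\<forall>\<^sub>F n in sequentially. a < L - D * real n powr (\<alpha> - 1 / 2) - (\<epsilon> + real n powr (\<alpha> - 1))
        - 2 * (real J + 1) * sqrt 2 * real n powr (\<alpha> - 1 / 2)"
      using \<epsilon> by (intro order_tendstoD(1)) auto
    moreover have "\<forall>\<^sub>F n in sequentially. real n powr (\<alpha> - 1) * charged_mean \<alpha> 0 0 n < L + 1"
      by (rule order_tendstoD(2)[OF L]) simp
    ultimately show "\<forall>\<^sub>F n in sequentially. a < ?b n"
      using eventually_gt_at_top[of 0]
    proof eventually_elim
      case (elim n)
      let ?r = "real n powr (\<alpha> - 1)" and ?R = "real n powr (1 - \<alpha>)"
      have r: "0 < ?r" "0 < ?R" "?r * ?R = 1" "?R * ?r = 1"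
        using elim(3) by (simp_all flip: powr_add)
      have s0: "0 < s n" using r \<epsilon> by (simp add: s_def)
      have s1: "\<epsilon> * ?R \<le> s n" unfolding s_def by linarith
      have s2: "s n \<le> \<epsilon> * ?R + 1" unfolding s_def using of_int_ceiling_le_add_one[of "\<epsilon> * ?R"] r \<epsilon> by simp
      have f: "charged_mean \<alpha> 0 0 n \<le> ?R * (L + 1)"
        using mult_left_mono[OF less_imp_le[OF elim(2)], of ?R] r by (simp add: mult.assoc[symmetric])
      have "2 * charged_mean \<alpha> 0 0 n \<le> ?R * (2 * (L + 1))"
        using f by (simp only: mult.left_commute[of ?R 2])
      also have "\<dots> \<le> ?R * (\<epsilon> * (J + 1))" using J r by (intro mult_left_mono) auto
      also have "\<dots> = (\<epsilon> * ?R) * (J + 1)" by simp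
      also have "\<dots> \<le> s n * real (J + 1)" using s1 by (intro mult_mono) auto
      finally have Js: "2 * charged_mean \<alpha> 0 0 n \<le> real (s n) * (real J + 1)" by (simp add: add.commute)
      let ?l = "?R * (L - D * real n powr (\<alpha> - 1 / 2))"
      have "?l \<le> charged_mean \<alpha> p q n" for p q
        using mult_left_mono[OF lower[OF elim(3), of p q], of ?R] r by (simp add: mult.assoc[symmetric])
      from boundary_mean_ge[OF \<alpha>(1) \<alpha>1 s0 this Js]
      have "?r * (?l - s n - 2 * (J + 1) * sqrt (2 * n)) \<le> ?b n"
        using r by (intro mult_left_mono) auto
      moreover have "?r * (?l - (\<epsilon> * ?R + 1) - 2 * (J + 1) * sqrt (2 * n)) \<le>
          ?r * (?l - s n - 2 * (J + 1) * sqrt (2 * n))"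
        using r s2 by (intro mult_left_mono) auto
      moreover have "a < ?r * (?l - (\<epsilon> * ?R + 1) - 2 * (J + 1) * sqrt (2 * n))"
      proof -
        have sqrt_n: "?r * sqrt n = real n powr (\<alpha> - 1 / 2)"
          by (simp add: powr_half_sqrt[symmetric] powr_add[symmetric])
        have "?r * (?l - (\<epsilon> * ?R + 1) - 2 * (J + 1) * sqrt (2 * n)) =
          (?r * ?R) * (L - D * real n powr (\<alpha> - 1 / 2)) - ((?r * ?R) * \<epsilon> + ?r)
          - 2 * (real J + 1) * sqrt 2 * (?r * sqrt n)"
          by (simp add: algebra_simps real_sqrt_mult)
        with elim(1) show ?thesis unfolding sqrt_n r(3) mult_1 by simp
      qed
      ultimately show ?case by linarith
    qed
  }
qed

lemma (in prob_space) indep_vars_concat: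
  fixes X Y :: "nat \<Rightarrow> 'a \<Rightarrow> 'b"
  assumes "indep_vars (\<lambda>_. N) (case_sum X Y) UNIV"
  shows "indep_vars (\<lambda>_. N) (\<lambda>i. if i < n then X i else Y (i - n)) {..<m}"
proof -
  define f where "f i = (if i < n then Inl i else Inr (i - n))" for i
  have "inj_on f {..<m}" by (auto simp: inj_on_def f_def split: if_splits)
  then have "indep_vars (\<lambda>_. N) (\<lambda>i. case_sum X Y (f i)) {..<m}"
    by (rule indep_vars_reindex[OF indep_vars_subset[OF assms subset_UNIV]])
  moreover have "(\<lambda>i. case_sum X Y (f i)) = (\<lambda>i. if i < n then X i else Y (i - n))"
    by (auto simp: f_def)
  ultimately show ?thesis by simp
qed

theorem mainTheorem3:
  fixes M :: "'a measure" and X Y :: "nat \<Rightarrow> 'a \<Rightarrow> real" and \<alpha> :: real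
  assumes "0 < \<alpha>" "\<alpha> < 1 / 2"
    and "prob_space M"
    and "prob_space.indep_vars M (\<lambda>_. borel) (case_sum X Y) (UNIV :: (nat + nat) set)"
    and "\<And>i. distr M borel (X i) = uniform_measure lborel {0..1}"
    and "\<And>i. distr M borel (Y i) = uniform_measure lborel {0..1}"
  shows "\<exists>L :: real.
    (\<lambda>n. real n powr (\<alpha> - 1) * prob_space.expectation M
       (\<lambda>\<omega>. boundary_assignment_cost \<alpha> (map (\<lambda>i. X i \<omega>) [0..<n]) (map (\<lambda>i. Y i \<omega>) [0..<n])))
      \<longlonglongrightarrow> L \<and>
    (\<lambda>n. real n powr (\<alpha> - 1) * prob_space.expectation M
       (\<lambda>\<omega>. assignment_cost \<alpha> (map (\<lambda>i. X i \<omega>) [0..<n]) (map (\<lambda>i. Y i \<omega>) [0..<n])))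
      \<longlonglongrightarrow> L"
proof -
  interpret prob_space M by fact
  have \<alpha>1: "\<alpha> \<le> 1" using assms(2) by simp
  \<comment> \<open>The two samples as one sequence of length 2 n. It depends on \<open>n\<close>,
    as the second block starts at position \<open>n\<close>; this is harmless because only the mean
    for each separate \<open>n\<close> is computed.\<close>
  define Z where "Z n i = (if i < n then X i else Y (i - n))" for n i
  have mean: "expectation (\<lambda>\<omega>. F (map (\<lambda>i. Z n i \<omega>) [0..<2 * n])) = iid_mean (2 * n) F"
    if "coord_hoelder \<alpha> UNIV 1 (2 * n) F" for n F
    using indep_vars_concat[OF assms(4), of n "2 * n"] assms(1,5,6)
    by (intro expectation_eq_iid_mean[OF that]) (auto simp: Z_def[abs_def])
  have "map (\<lambda>i. Z n i \<omega>) [0..<2 * n] = map (\<lambda>i. X i \<omega>) [0..<n] @ map (\<lambda>i. Y i \<omega>) [0..<n]" for n \<omega>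
    by (auto simp: list_eq_iff_nth_eq nth_append Z_def)
  then have Z: "take n (map (\<lambda>i. Z n i \<omega>) [0..<2 * n]) = map (\<lambda>i. X i \<omega>) [0..<n]"
    "drop n (map (\<lambda>i. Z n i \<omega>) [0..<2 * n]) = map (\<lambda>i. Y i \<omega>) [0..<n]" for n \<omega>
    by simp_all
  have boundary: "expectation (\<lambda>\<omega>. boundary_assignment_cost \<alpha> (map (\<lambda>i. X i \<omega>) [0..<n]) (map (\<lambda>i. Y i \<omega>) [0..<n]))
      = iid_mean (2 * n) (split_boundary_cost \<alpha> n)" for n
    using mean[OF coord_hoelder_boundary_assignment_cost[OF assms(1) \<alpha>1]] unfolding Z .
  have plain: "expectation (\<lambda>\<omega>. assignment_cost \<alpha> (map (\<lambda>i. X i \<omega>) [0..<n]) (map (\<lambda>i. Y i \<omega>) [0..<n]))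
      = charged_mean \<alpha> 0 0 n" for n
    using mean[OF coord_hoelder_charged_cost[OF assms(1) \<alpha>1, of UNIV n 0 0]]
    unfolding charged_mean_def charged_cost_def Z by simp
  obtain L D where "(\<lambda>n. real n powr (\<alpha> - 1) * charged_mean \<alpha> 0 0 n) \<longlonglongrightarrow> L"
    "\<And>p q n. 0 < n \<Longrightarrow> L - D * real n powr (\<alpha> - 1 / 2) \<le> real n powr (\<alpha> - 1) * charged_mean \<alpha> p q n"
    using charged_mean_limit[OF assms(1,2)] by blast
  with boundary_mean_limit[OF assms(1,2) this] show ?thesis unfolding boundary plain by blast
qed

end
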